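(* Let $\ell>0$, let $\mathcal{V}\in\mathbb{R}^{3V}$ be a closed space polygon with $\mathrm{CThi}(\ell,\mathcal{V})\ge 1$, and let $f$ be a differentiable function on the space of polygons $\mathbb{R}^{3V}$. The following are equivalent: (1) $\mathcal{V}$ is thickness-critical for minimizing $f$; (2) $-\nabla f(\mathcal{V})\in R(\mathcal{V})$; (3) the constrained gradient $(-\nabla f)_I$ at $\mathcal{V}$ vanishes.
   Context: A closed space polygon $\mathcal{V}$ (possibly with several components) has vertices $v_1,\dots,v_V\in\mathbb{R}^3$ and edges $e_1,\dots,e_V$, where $e_{i-1},e_i$ are the edges meeting at $v_i$ (indices cyclic on each component); it is viewed as $(v_1,\dots,v_V)\in\mathbb{R}^{3V}$. $\theta_i$ denotes the turning angle at $v_i$. $\mathrm{MinRad}(v_i)=\min\{\mathrm{MinRad}^-(v_i),\mathrm{MinRad}^+(v_i)\}$ with $\mathrm{MinRad}^-(v_i)=\frac{|e_{i-1}|}{2\tan(\theta_i/2)}$ and $\mathrm{MinRad}^+(v_i)=\frac{|e_i|}{2\tan(\theta_i/2)}$; vertices with $\theta_i=0$, where these are undefined (infinite), are ignored in minima. For points $p,q$ on $\mathcal{V}$, $d(p,q)=\|p-q\|$. Let $\theta(1,\ell)=2\arctan(\ell/2)$. Let $\mathrm{vb}(p,q)$ be $\infty$ if $p,q$ lie on different components of $\mathcal{V}$, and otherwise the smaller (over the two arcs joining $p$ and $q$) of the number of vertices between $p$ and $q$, counting $p$ and/or $q$ if they are vertices. Set $\mathrm{VB}(1,\ell)=\{(p,q)\in\mathcal{V}\times\mathcal{V}: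 \mathrm{vb}(p,q)\ge \pi/\theta(1,\ell)\}$. The constraint thickness is $$\mathrm{CThi}(\ell,\mathcal{V})=\min\Big\{\min_i \mathrm{MinRad}(v_i),\ \min_{(p,q)\in \mathrm{VB}(1,\ell)}\tfrac{d(p,q)}{2}\Big\}.$$ $\mathrm{Strut}(\mathcal{V})$ is the set of pairs $(p,q)\in\mathrm{VB}(1,\ell)$ with $d(p,q)/2=1$ such that either $(p,q)$ is an isolated local minimum of $d$ (as a function on $\mathrm{VB}(1,\ell)$), or $(p,q)$ is an endpoint of a family (a nondegenerate interval of corresponding pairs, lying on two parallel edges) of local minima of $d$. $\mathrm{Kink}(\mathcal{V})$ is the set of pairs $(v_i,\pm)$ with $\mathrm{MinRad}^{\pm}(v_i)=1$. Both sets are finite, and empty if $\mathrm{CThi}(\ell,\mathcal{V})>1$. A variation $W=(w_1,\dots,w_V)\in\mathbb{R}^{3V}$ moves $\mathcal{V}$ to $\mathcal{V}+tW$, carrying $p=\alpha v_i+(1-\alpha)v_{i+1}$ to the point with the same $\alpha$ on the moved edge; gradients of $d(p,q)/2$ and $\mathrm{MinRad}^\pm v_i$ are taken in $\mathbb{R}^{3V}$ with respect to the vertex positions with these $\alpha$'s fixed. $D_W g(\mathcal{V})=\frac{d}{dt^+}g(\mathcal{V}+tW)|_{t=0}$ denotes the forward directional derivative. If $\mathrm{CThi}(\ell,\mathcal{V})=1$, $W$ is an infinitesimal motion of $\mathcal{V}$ if $D_W\mathrm{CThi}(\ell,\mathcal{V})\ge 0$; if $\mathrm{CThi}(\ell,\mathcal{V})>1$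 every variation is an infinitesimal motion. $I(\mathcal{V})$ is the set of all infinitesimal motions (a closed convex cone). The cone $R(\mathcal{V})$ of resolvable motions is the convex cone generated by the vectors $-\nabla\frac{d(p,q)}{2}$ for $(p,q)\in\mathrm{Strut}(\mathcal{V})$ and $-\nabla\,\mathrm{MinRad}^{\pm}v_i$ for $(v_i,\pm)\in\mathrm{Kink}(\mathcal{V})$, i.e. the set of all linear combinations of these vectors with nonnegative coefficients (it is $\{0\}$ if there are none). The constrained gradient $(-\nabla f)_I$ of $-f$ is the closest vector in $I(\mathcal{V})$ to $-\nabla f(\mathcal{V})$. $\mathcal{V}$ is thickness-critical for minimizing $f$ if either $D_W f(\mathcal{V})=0$ for all $W$, or $\mathrm{CThi}(\ell,\mathcal{V})=1$ and for every $W$ with $D_W f(\mathcal{V})<0$ we have $D_W\mathrm{CThi}(\ell,\mathcal{V})<0$. *)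

theory Defs
  imports "HOL-Analysis.Analysis" "HOL-Combinatorics.Orbits"
begin

text \<open>
  A polygon with vertices indexed by the finite type \<^typ>\<open>'n\<close> is a point of
  \<^typ>\<open>real^3^'n\<close>, the Euclidean space \<open>\<real>\<^sup>3\<^sup>V\<close>. Its combinatorics is a permutation \<open>nxt\<close>
  of \<^typ>\<open>'n\<close>: the successor of vertex \<open>i\<close> is \<open>nxt i\<close>, the components are the orbits of
  \<open>nxt\<close>, and edge \<open>i\<close> runs from vertex \<open>i\<close> to vertex \<open>nxt i\<close>.
\<close>

definition edge :: "('n::finite \<Rightarrow> 'n) \<Rightarrow> real^3^'n \<Rightarrow> 'n \<Rightarrow> real^3" where
  "edge nxt V i = V $ nxt i - V $ i"

definition closed_polygon :: "('n::finite \<Rightarrow> 'n) \<Rightarrow> real^3^'n \<Rightarrow> bool" where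
  "closed_polygon nxt V \<longleftrightarrow>
     bij nxt \<and> (\<forall>i. 3 \<le> card (orbit nxt i)) \<and> (\<forall>i. edge nxt V i \<noteq> 0)"


subsection \<open>Turning angles and MinRad\<close>

definition turning_angle :: "('n::finite \<Rightarrow> 'n) \<Rightarrow> real^3^'n \<Rightarrow> 'n \<Rightarrow> real" where
  "turning_angle nxt V i =
     (let e = edge nxt V (inv nxt i); e' = edge nxt V i
      in arccos ((e \<bullet> e') / (norm e * norm e')))"

datatype side = Minus | Plus

fun side_edge :: "('n::finite \<Rightarrow> 'n) \<Rightarrow> real^3^'n \<Rightarrow> 'n \<Rightarrow> side \<Rightarrow> real^3" where
  "side_edge nxt V i Minus = edge nxt V (inv nxt i)"
| "side_edge nxt V i Plus = edge nxt V i"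

text \<open>
  At turning angle \<open>0\<close> the value should be infinite, whereas HOL's \<open>x / 0 = 0\<close> yields \<open>0\<close>;
  every use below excludes that case. At turning angle \<open>\<pi>\<close> the conventions \<open>tan (\<pi>/2) = 0\<close>
  and \<open>x / 0 = 0\<close> yield the intended value \<open>0\<close>.
\<close>

definition min_rad_side :: "('n::finite \<Rightarrow> 'n) \<Rightarrow> 'n \<Rightarrow> side \<Rightarrow> real^3^'n \<Rightarrow> real" where
  "min_rad_side nxt i s V = norm (side_edge nxt V i s) / (2 * tan (turning_angle nxt V i / 2))"

definition min_rad :: "('n::finite \<Rightarrow> 'n) \<Rightarrow> real^3^'n \<Rightarrow> 'n \<Rightarrow> real" where
  "min_rad nxt V i = min (min_rad_side nxt i Minus V) (min_rad_side nxt i Plus V)"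


subsection \<open>Points of a polygon and pairs beyond the vertex barrier\<close>

text \<open>
  A point of a polygon is represented by its vector of barycentric coordinates in
  \<^typ>\<open>real^'n\<close>: \<open>\<alpha> v\<^sub>i + (1 - \<alpha>) v\<^sub>i\<^sub>+\<^sub>1\<close> becomes \<open>\<alpha> *\<^sub>R axis i 1 + (1 - \<alpha>) *\<^sub>R axis (nxt i) 1\<close>.
  The head of one edge and the tail of the next are thereby the same point, points of
  different edges that happen to coincide in space stay distinct, the topology induced from
  \<^typ>\<open>real^'n\<close> is that of a disjoint union of circles, and a point keeps its
  coordinates when the vertices move.
\<close>

definition edge_points :: "('n::finite \<Rightarrow> 'n) \<Rightarrow> 'n \<Rightarrow> (real^'n) set" where
  "edge_points nxt i = closed_segment (axis i 1) (axis (nxt i) 1)"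

definition polygon_points :: "('n::finite \<Rightarrow> 'n) \<Rightarrow> (real^'n) set" where
  "polygon_points nxt = (\<Union>i. edge_points nxt i)"

definition position :: "real^3^'n::finite \<Rightarrow> real^'n \<Rightarrow> real^3" where
  "position V p = (\<Sum>i\<in>UNIV. (p $ i) *\<^sub>R (V $ i))"

definition separation :: "real^3^'n::finite \<Rightarrow> (real^'n) \<times> (real^'n) \<Rightarrow> real" where
  "separation V z = dist (position V (fst z)) (position V (snd z))"

text \<open>
  Uniform parametrization of the component of vertex \<open>i\<close> by \<open>[0, \<infinity>)\<close>, winding around it
  periodically; the natural numbers are exactly the parameters of the vertices.
\<close>

definition walk :: "('n::finite \<Rightarrow> 'n) \<Rightarrow> 'n \<Rightarrow> real \<Rightarrow> real^'n" where
  "walk nxt i t =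
     (let k = nat \<lfloor>t\<rfloor>
      in (1 - frac t) *\<^sub>R axis ((nxt ^^ k) i) 1 + frac t *\<^sub>R axis ((nxt ^^ Suc k) i) 1)"

text \<open>
  The numbers of vertices on the arcs joining \<open>p\<close> and \<open>q\<close>, endpoints included. An arc is
  the image of a parameter interval shorter than one period. For \<open>p \<noteq> q\<close> on one component
  there are exactly two arcs, one traversed from \<open>p\<close> to \<open>q\<close> and one from \<open>q\<close> to \<open>p\<close>; for
  points on different components there is none, which makes \<open>vb\<close> infinite.
\<close>

definition arc_counts :: "('n::finite \<Rightarrow> 'n) \<Rightarrow> real^'n \<Rightarrow> real^'n \<Rightarrow> nat set" where
  "arc_counts nxt p q =
     {card {k::nat. s \<le> real k \<and> real k \<le> t} | i s t.
        0 \<le> s \<and> s \<le> t \<and> t < s + real (card (orbit nxt i)) \<and>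
        (walk nxt i s = p \<and> walk nxt i t = q \<or> walk nxt i s = q \<and> walk nxt i t = p)}"

definition vb :: "('n::finite \<Rightarrow> 'n) \<Rightarrow> real^'n \<Rightarrow> real^'n \<Rightarrow> ereal" where
  "vb nxt p q = (INF c\<in>arc_counts nxt p q. ereal (real c))"

definition theta1 :: "real \<Rightarrow> real" where
  "theta1 l = 2 * arctan (l / 2)"

definition VB1 :: "('n::finite \<Rightarrow> 'n) \<Rightarrow> real \<Rightarrow> ((real^'n) \<times> (real^'n)) set" where
  "VB1 nxt l = {(p, q) \<in> polygon_points nxt \<times> polygon_points nxt. vb nxt p q \<ge> ereal (pi / theta1 l)}"


subsection \<open>Constraint thickness, struts and kinks\<close>

text \<open>
  For a closed polygon the following set is nonempty, since some turning angle is nonzero,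
  and bounded below by \<open>0\<close>; its infimum is attained because \<open>VB1 nxt l\<close> is compact.
\<close>

definition CThi :: "('n::finite \<Rightarrow> 'n) \<Rightarrow> real \<Rightarrow> real^3^'n \<Rightarrow> real" where
  "CThi nxt l V =
     Inf (min_rad nxt V ` {i. turning_angle nxt V i \<noteq> 0} \<union> (\<lambda>z. separation V z / 2) ` VB1 nxt l)"

definition local_minima :: "('n::finite \<Rightarrow> 'n) \<Rightarrow> real \<Rightarrow> real^3^'n \<Rightarrow> ((real^'n) \<times> (real^'n)) set" where
  "local_minima nxt l V =
     {z \<in> VB1 nxt l. \<forall>\<^sub>F z' in at z within VB1 nxt l. separation V z \<le> separation V z'}"

definition parallel_edges :: "('n::finite \<Rightarrow> 'n) \<Rightarrow> real^3^'n \<Rightarrow> 'n \<Rightarrow> 'n \<Rightarrow> bool" where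
  "parallel_edges nxt V i j \<longleftrightarrow> (\<exists>c. edge nxt V j = c *\<^sub>R edge nxt V i)"

text \<open>\<open>z\<close> and \<open>z'\<close> bound a nondegenerate interval of local minima lying on two parallel edges.\<close>

definition minima_interval ::
  "('n::finite \<Rightarrow> 'n) \<Rightarrow> real \<Rightarrow> real^3^'n \<Rightarrow> (real^'n) \<times> (real^'n) \<Rightarrow> (real^'n) \<times> (real^'n) \<Rightarrow> bool" where
  "minima_interval nxt l V z z' \<longleftrightarrow>
     z \<noteq> z' \<and> closed_segment z z' \<subseteq> local_minima nxt l V \<and>
     (\<exists>i j. parallel_edges nxt V i j \<and> closed_segment z z' \<subseteq> edge_points nxt i \<times> edge_points nxt j)"

text \<open>A family is a maximal such interval; \<open>z\<close> ranges over both of its endpoints by symmetry.\<close>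

definition family_endpoint ::
  "('n::finite \<Rightarrow> 'n) \<Rightarrow> real \<Rightarrow> real^3^'n \<Rightarrow> (real^'n) \<times> (real^'n) \<Rightarrow> bool" where
  "family_endpoint nxt l V z \<longleftrightarrow>
     (\<exists>z'. minima_interval nxt l V z z' \<and>
        (\<forall>u u'. minima_interval nxt l V u u' \<and> closed_segment z z' \<subseteq> closed_segment u u' \<longrightarrow>
           closed_segment u u' = closed_segment z z'))"

definition Strut :: "('n::finite \<Rightarrow> 'n) \<Rightarrow> real \<Rightarrow> real^3^'n \<Rightarrow> ((real^'n) \<times> (real^'n)) set" where
  "Strut nxt l V =
     {z \<in> VB1 nxt l. separation V z / 2 = 1 \<and>
        (z isolated_in local_minima nxt l V \<or> family_endpoint nxt l V z)}"

definition Kink :: "('n::finite \<Rightarrow> 'n) \<Rightarrow> real^3^'n \<Rightarrow> ('n \<times> side) set" where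
  "Kink nxt V = {(i, s). turning_angle nxt V i \<noteq> 0 \<and> min_rad_side nxt i s V = 1}"


subsection \<open>Variations\<close>

definition forward_deriv :: "'a::real_vector \<Rightarrow> ('a \<Rightarrow> real) \<Rightarrow> 'a \<Rightarrow> real" where
  "forward_deriv W g V = Lim (at_right 0) (\<lambda>t. (g (V + t *\<^sub>R W) - g V) / t)"

definition gradient :: "('a::real_inner \<Rightarrow> real) \<Rightarrow> 'a \<Rightarrow> 'a" where
  "gradient g V = (THE D. GDERIV g V :> D)"

definition infinitesimal_motions :: "('n::finite \<Rightarrow> 'n) \<Rightarrow> real \<Rightarrow> real^3^'n \<Rightarrow> (real^3^'n) set" where
  "infinitesimal_motions nxt l V =
     (if CThi nxt l V > 1 then UNIV else {W. forward_deriv W (CThi nxt l) V \<ge> 0})"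

definition resolvable_motions :: "('n::finite \<Rightarrow> 'n) \<Rightarrow> real \<Rightarrow> real^3^'n \<Rightarrow> (real^3^'n) set" where
  "resolvable_motions nxt l V = convex_cone hull
     ((\<lambda>z. - gradient (\<lambda>U. separation U z / 2) V) ` Strut nxt l V \<union>
      (\<lambda>(i, s). - gradient (min_rad_side nxt i s) V) ` Kink nxt V)"

definition constrained_gradient ::
  "('n::finite \<Rightarrow> 'n) \<Rightarrow> real \<Rightarrow> (real^3^'n \<Rightarrow> real) \<Rightarrow> real^3^'n \<Rightarrow> real^3^'n" where
  "constrained_gradient nxt l f V = closest_point (infinitesimal_motions nxt l V) (- gradient f V)"

definition thickness_critical ::
  "('n::finite \<Rightarrow> 'n) \<Rightarrow> real \<Rightarrow> (real^3^'n \<Rightarrow> real) \<Rightarrow> real^3^'n \<Rightarrow> bool" where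
  "thickness_critical nxt l f V \<longleftrightarrow>
     (\<forall>W. forward_deriv W f V = 0) \<or>
     (CThi nxt l V = 1 \<and>
      (\<forall>W. forward_deriv W f V < 0 \<longrightarrow> forward_deriv W (CThi nxt l) V < 0))"

end

theory Submission
  imports Defs
begin

text \<open>
  All three conditions say that \<open>m = - \<nabla>f(V)\<close> satisfies \<open>m \<bullet> W \<le> 0\<close> for every infinitesimal motion
  \<open>W\<close>. This rests on one fact of analysis: when the thickness is 1, its forward derivative in
  direction \<open>W\<close> is the minimum of \<open>g \<bullet> W\<close> over the gradients \<open>g\<close> of the struts and kinks
  (\<open>forward_deriv_CThi\<close>), and there are finitely many of these (\<open>finite_Strut\<close>). Therefore the
  infinitesimal motions form the closed convex cone of all \<open>W\<close> with \<open>g \<bullet> W \<ge> 0\<close> for all active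
  gradients \<open>g\<close>. When the thickness exceeds 1 nothing is active and the description still holds.
  Farkas' lemma (\<open>mem_convex_cone_hull_iff_polar\<close>) says that \<open>m\<close> lies in
  the polar of this cone iff it is resolvable; projection onto a closed convex cone gives zero exactly on
  the polar cone (\<open>closest_point_cone_eq_0_iff\<close>); and the definition of criticality is the
  contrapositive of polarity.

  The upper bound for the derivative of the thickness is immediate, as the thickness lies below every
  active function. For the lower bound, the separation of a pair is convex in the vertices, so it
  grows at least linearly with its initial rate. The pairs whose rate is too small form a compact
  set. If that set contains no contact, that is, no pair at distance exactly 2, then the distances
  on it exceed 2 by a margin and the pairs do no harm for a short time
  (\<open>separation_variation_ge_uniform\<close>). MinRad is differentiable at bent vertices and large at
  vertices that are nearly straight.

  What remains is that the struts control the rates at all contacts. The region beyond the vertex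
  barrier is a finite union of products of closed faces (\<open>VB1_eq_Union_cells\<close>), because sliding a
  point from an open edge to its closure cannot lower the vertex count (\<open>vb_ge_slide\<close>). On a
  convex cell the separation is convex and local minima are global. Two contacts in one cell have
  the same displacement by strict convexity of the norm, so they lie on parallel edges, and the
  contacts on these two edges form a segment whose ends are struts (\<open>contact_interval\<close>). Along
  the segment the rate is affine and so is least at an end (\<open>contact_rate_gt\<close>). A contact that
  shares no cell with another local minimum is isolated and a strut itself
  (\<open>contact_between_struts\<close>).
\<close>


section \<open>Gradients and one-sided directional derivatives\<close>

text \<open>The Riesz representation of the derivative, written out in an orthonormal basis.\<close>

lemma GDERIV_gradient:
  fixes g :: "'a::euclidean_space \<Rightarrow> real"
  assumes "g differentiable (at x)"
  shows "GDERIV g x :> gradient g x"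
proof -
  obtain g' where g': "(g has_derivative g') (at x)"
    using assms by (auto simp: differentiable_def)
  then interpret bounded_linear g'
    by (rule has_derivative_bounded_linear)
  have "g' = (\<lambda>h. h \<bullet> (\<Sum>b\<in>Basis. g' b *\<^sub>R b))"
  proof
    fix h
    have "g' h = g' (\<Sum>b\<in>Basis. (h \<bullet> b) *\<^sub>R b)"
      by (simp add: euclidean_representation)
    also have "\<dots> = h \<bullet> (\<Sum>b\<in>Basis. g' b *\<^sub>R b)"
      by (simp add: sum scaleR inner_sum_right mult.commute)
    finally show "g' h = h \<bullet> (\<Sum>b\<in>Basis. g' b *\<^sub>R b)" .
  qed
  with g' have D: "GDERIV g x :> (\<Sum>b\<in>Basis. g' b *\<^sub>R b)"
    unfolding gderiv_def by simp
  have unique: "D = D'" if "GDERIV g x :> D" "GDERIV g x :> D'" for D D'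
  proof -
    have "(\<lambda>h. h \<bullet> D) = (\<lambda>h. h \<bullet> D')"
      using that has_derivative_unique unfolding gderiv_def by blast
    then show "D = D'"
      by (metis inner_commute vector_eq_rdot)
  qed
  from D have "gradient g x = (\<Sum>b\<in>Basis. g' b *\<^sub>R b)"
    unfolding gradient_def by (rule the_equality) (rule unique[OF _ D])
  with D show ?thesis by simp
qed

lemma difference_quotient_tendsto_gradient:
  fixes g :: "'a::euclidean_space \<Rightarrow> real"
  assumes "g differentiable (at x)"
  shows "((\<lambda>t. (g (x + t *\<^sub>R W) - g x) / t) \<longlongrightarrow> gradient g x \<bullet> W) (at_right 0)"
proof -
  have "((\<lambda>t. g (x + t *\<^sub>R W)) has_derivative (\<lambda>t. (t *\<^sub>R W) \<bullet> gradient g x)) (at 0)"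
    using GDERIV_gradient[OF assms] unfolding gderiv_def
    by (intro has_derivative_compose[where f = "\<lambda>t. x + t *\<^sub>R W" and g = g])
       (auto intro!: derivative_eq_intros)
  then have "((\<lambda>t. g (x + t *\<^sub>R W)) has_real_derivative gradient g x \<bullet> W) (at 0)"
    by (simp add: has_field_derivative_def inner_commute mult_commute_abs)
  then have "((\<lambda>t. (g (x + t *\<^sub>R W) - g x) / t) \<longlongrightarrow> gradient g x \<bullet> W) (at 0)"
    by (simp add: DERIV_def)
  then show ?thesis
    by (rule tendsto_mono[rotated]) (simp add: at_le)
qed

lemma forward_deriv_eqI:
  assumes "((\<lambda>t. (g (x + t *\<^sub>R W) - g x) / t) \<longlongrightarrow> L) (at_right 0)"
  shows "forward_deriv W g x = L"
  unfolding forward_deriv_def by (rule tendsto_Lim[OF _ assms]) simp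

lemma forward_deriv_eq_gradient:
  fixes g :: "'a::euclidean_space \<Rightarrow> real"
  assumes "g differentiable (at x)"
  shows "forward_deriv W g x = gradient g x \<bullet> W"
  by (rule forward_deriv_eqI) (rule difference_quotient_tendsto_gradient[OF assms])


section \<open>Polar cones\<close>

text \<open>Farkas: a finitely generated cone is closed, so a vector outside it is strictly separated
  from it, and since the cone is invariant under scaling the separating functional can be taken
  to be nonpositive on the cone.\<close>

lemma mem_convex_cone_hull_iff_polar:
  fixes G :: "'a::euclidean_space set"
  assumes "finite G"
  shows "m \<in> convex_cone hull G \<longleftrightarrow> (\<forall>W. (\<forall>g\<in>G. g \<bullet> W \<le> 0) \<longrightarrow> m \<bullet> W \<le> 0)"
proof (intro iffI allI impI)
  fix W
  assume m: "m \<in> convex_cone hull G" and G: "\<forall>g\<in>G. g \<bullet> W \<le> 0"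
  have "convex_cone hull G \<subseteq> {x. W \<bullet> x \<le> 0}"
  proof (rule hull_minimal)
    show "G \<subseteq> {x. W \<bullet> x \<le> 0}"
      using G by (auto simp: inner_commute)
  qed (rule convex_cone_halfspace_le)
  with m have "m \<in> {x. W \<bullet> x \<le> 0}" by blast
  then show "m \<bullet> W \<le> 0"
    by (simp add: inner_commute)
next
  assume polar: "\<forall>W. (\<forall>g\<in>G. g \<bullet> W \<le> 0) \<longrightarrow> m \<bullet> W \<le> 0"
  let ?K = "convex_cone hull G"
  show "m \<in> ?K"
  proof (rule ccontr)
    assume "m \<notin> ?K"
    then obtain a b where ab: "a \<bullet> m < b" "\<And>x. x \<in> ?K \<Longrightarrow> b < a \<bullet> x"
      using separating_hyperplane_closed_point
        [OF convex_convex_cone_hull closed_convex_cone_hull[OF assms]] by metis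
    have "b < 0"
      using ab(2)[OF convex_cone_hull_contains_0] by simp
    have "a \<bullet> x \<ge> 0" if "x \<in> ?K" for x
    proof (rule ccontr)
      assume "\<not> a \<bullet> x \<ge> 0"
      then have "0 \<le> b / (a \<bullet> x)"
        using \<open>b < 0\<close> by (simp add: divide_nonpos_neg)
      then have "(b / (a \<bullet> x)) *\<^sub>R x \<in> ?K"
        using that by (intro convex_cone_hull_mul)
      from ab(2)[OF this] show False
        using \<open>\<not> a \<bullet> x \<ge> 0\<close> by simp
    qed
    then have "\<forall>g\<in>G. g \<bullet> (- a) \<le> 0"
      by (auto simp: inner_commute hull_inc)
    with polar have "m \<bullet> (- a) \<le> 0" by blast
    with ab(1) \<open>b < 0\<close> show False
      by (simp add: inner_commute)
  qed
qed

text \<open>This is the variational inequality that characterizes projections, at the apex of the cone.\<close>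

lemma closest_point_cone_eq_0_iff:
  fixes I :: "'a::euclidean_space set"
  assumes "convex_cone I" "closed I"
  shows "closest_point I m = 0 \<longleftrightarrow> (\<forall>W\<in>I. m \<bullet> W \<le> 0)"
proof
  have "convex I" "I \<noteq> {}" "0 \<in> I"
    using assms(1) by (auto simp: convex_cone_def convex_cone_contains_0)
  {
    assume "closest_point I m = 0"
    then show "\<forall>W\<in>I. m \<bullet> W \<le> 0"
      using closest_point_dot[OF \<open>convex I\<close> assms(2), of _ m] by auto
  next
    assume polar: "\<forall>W\<in>I. m \<bullet> W \<le> 0"
    have "dist m 0 \<le> dist m W" if "W \<in> I" for W
    proof -
      have "(norm (m - W))\<^sup>2 = (norm m)\<^sup>2 - 2 * (m \<bullet> W) + (norm W)\<^sup>2"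
        by (simp add: power2_norm_eq_inner inner_diff inner_commute)
      then have "(norm m)\<^sup>2 \<le> (norm (m - W))\<^sup>2"
        using polar[rule_format, OF that] zero_le_power2[of "norm W"] by linarith
      then show ?thesis
        unfolding dist_norm by (auto intro: power2_le_imp_le)
    qed
    then show "closest_point I m = 0"
      by (intro closest_point_unique[OF \<open>convex I\<close> assms(2) \<open>0 \<in> I\<close>, symmetric] ballI)
  }
qed


section \<open>Cells of the region beyond the vertex barrier\<close>

subsection \<open>Edges of the abstract polygon\<close>

lemma nxt_neq_self:
  assumes "3 \<le> card (orbit nxt i)"
  shows "nxt i \<noteq> i"
proof
  assume "nxt i = i"
  have "x = i" if "x \<in> orbit nxt i" for x
    using that \<open>nxt i = i\<close> by (induction rule: orbit.induct) auto
  then have "orbit nxt i \<subseteq> {i}" by blast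
  from card_mono[OF _ this] assms show False by simp
qed

lemma nxt_nxt_neq_self:
  assumes "3 \<le> card (orbit nxt i)"
  shows "nxt (nxt i) \<noteq> i"
proof
  assume "nxt (nxt i) = i"
  have "x = i \<or> x = nxt i" if "x \<in> orbit nxt i" for x
    using that \<open>nxt (nxt i) = i\<close> by (induction rule: orbit.induct) auto
  then have "orbit nxt i \<subseteq> {i, nxt i}" by blast
  from card_mono[OF _ this] assms show False
    by (auto simp: card_insert_if split: if_splits)
qed

lemma funpow_period:
  fixes nxt :: "'n::finite \<Rightarrow> 'n"
  assumes "bij nxt"
  obtains N where "0 < N" "(nxt ^^ N) i = i" "N = card (orbit nxt i)"
proof -
  have "permutation nxt"
    using assms by (simp add: permutation)
  then have "i \<in> orbit nxt i"
    by (rule permutation_self_in_orbit)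
  then have "orbit nxt i = (\<lambda>n. (nxt ^^ n) i) ` {0..<funpow_dist1 nxt i i}"
    and "inj_on (\<lambda>n. (nxt ^^ n) i) {0..<funpow_dist1 nxt i i}"
    and "(nxt ^^ funpow_dist1 nxt i i) i = i"
    by (rule orbit_conv_funpow_dist1 inj_on_funpow_dist1 funpow_dist1_prop)+
  then show ?thesis
    by (intro that[of "funpow_dist1 nxt i i"]) (simp_all add: card_image)
qed

definition edge_point :: "('n::finite \<Rightarrow> 'n) \<Rightarrow> 'n \<Rightarrow> real \<Rightarrow> real^'n" where
  "edge_point nxt k a = (1 - a) *\<^sub>R axis k 1 + a *\<^sub>R axis (nxt k) 1"

lemma edge_points_eq: "edge_points nxt k = edge_point nxt k ` {0..1}"
  unfolding edge_points_def edge_point_def closed_segment_def by auto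

lemma edge_point_0 [simp]: "edge_point nxt k 0 = axis k 1"
  and edge_point_1 [simp]: "edge_point nxt k 1 = axis (nxt k) 1"
  by (simp_all add: edge_point_def)

lemma edge_point_eq_iff:
  assumes "3 \<le> card (orbit nxt k)"
  shows "edge_point nxt k a = edge_point nxt k b \<longleftrightarrow> a = b"
proof
  assume "edge_point nxt k a = edge_point nxt k b"
  then have "edge_point nxt k a $ nxt k = edge_point nxt k b $ nxt k"
    by simp
  then show "a = b"
    using nxt_neq_self[OF assms] by (simp add: edge_point_def axis_def)
qed simp

text \<open>Two components of a point in an open edge are nonzero. They determine the unordered pair
  of the end vertices, and since no component is a digon they determine the edge.\<close>

lemma edge_point_inj:
  assumes card: "\<And>i. 3 \<le> card (orbit nxt i)"
    and eq: "edge_point nxt k a = edge_point nxt j b"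
    and a: "0 < a" "a < 1"
  shows "k = j" "a = b"
proof -
  have neq: "nxt k \<noteq> k" "nxt j \<noteq> j" "nxt (nxt k) \<noteq> k"
    using nxt_neq_self[OF card] nxt_nxt_neq_self[OF card] by blast+
  have "edge_point nxt k a $ k \<noteq> 0" "edge_point nxt k a $ nxt k \<noteq> 0"
    using a neq by (auto simp: edge_point_def axis_def)
  then have "edge_point nxt j b $ k \<noteq> 0" "edge_point nxt j b $ nxt k \<noteq> 0"
    by (simp_all add: eq)
  then have "k = j \<or> k = nxt j" "nxt k = j \<or> nxt k = nxt j"
    by (auto simp: edge_point_def axis_def split: if_splits)
  then show "k = j"
    using neq by metis
  then show "a = b"
    using eq card edge_point_eq_iff by metis
qed

lemma walk_edge_point:
  assumes "0 \<le> a" "a \<le> 1"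
  shows "walk nxt i (real m + a) = edge_point nxt ((nxt ^^ m) i) a"
proof (cases "a = 1")
  case True
  have "real m + a = real (Suc m)" using True by simp
  then have "walk nxt i (real m + a) = walk nxt i (real (Suc m))" by (rule arg_cong)
  also have "\<dots> = axis ((nxt ^^ Suc m) i) 1"
    unfolding walk_def by (simp add: Let_def frac_def del: of_nat_Suc)
  finally show ?thesis using True by simp
next
  case False
  then have "\<lfloor>real m + a\<rfloor> = int m" using assms by linarith
  then show ?thesis
    unfolding walk_def edge_point_def by (simp add: Let_def frac_def)
qed

lemma walk_period:
  assumes "(nxt ^^ N) i = i" "0 \<le> s"
  shows "walk nxt i (s + real N) = walk nxt i s"
proof -
  have "nat \<lfloor>s + real N\<rfloor> = nat \<lfloor>s\<rfloor> + N"
    using assms(2) by (simp add: nat_add_distrib)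
  moreover have "frac (s + real N) = frac s"
    by (simp add: frac_def)
  moreover have "(nxt ^^ (n + N)) i = (nxt ^^ n) i" for n
    using assms(1) by (simp add: funpow_add)
  ultimately show ?thesis
    unfolding walk_def Let_def
    by (simp only: funpow.simps o_apply)
qed

text \<open>The bound \<open>1 \<le> s\<close> leaves room for the edge that ends at parameter \<open>s\<close>.\<close>

lemma walk_eq_edge_pointE:
  assumes "bij nxt" and card: "\<And>i. 3 \<le> card (orbit nxt i)"
    and eq: "walk nxt i s = edge_point nxt k b" and b: "0 \<le> b" "b \<le> 1" and "1 \<le> s"
  obtains m where "(nxt ^^ m) i = k" "s = real m + b"
proof -
  define m c where "m = nat \<lfloor>s\<rfloor>" and "c = frac s"
  have s: "s = real m + c"
    using \<open>1 \<le> s\<close> by (simp add: m_def c_def frac_def)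
  have c: "0 \<le> c" "c < 1"
    by (simp_all add: c_def frac_lt_1)
  have eq': "edge_point nxt ((nxt ^^ m) i) c = edge_point nxt k b"
    using eq walk_edge_point[of c nxt i m] c s by simp
  consider "0 < c" | "c = 0" "0 < b" "b < 1" | "c = 0" "b = 0" | "c = 0" "b = 1"
    using b c by linarith
  then show thesis
  proof cases
    case 1
    then show thesis
      using that[of m] edge_point_inj[OF card eq'] c s by simp
  next
    case 2
    then show thesis
      using edge_point_inj[OF card eq'[symmetric]] by simp
  next
    case 3
    then show thesis
      using that[of m] eq' s by (simp add: axis_eq_axis)
  next
    case 4
    obtain m' where m': "m = Suc m'"
      using s \<open>1 \<le> s\<close> 4 by (cases m) auto
    have "nxt ((nxt ^^ m') i) = nxt k"
      using eq' 4 m' by (simp add: axis_eq_axis)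
    then have "(nxt ^^ m') i = k"
      using \<open>bij nxt\<close> by (simp add: bij_def inj_eq)
    then show thesis
      using that[of m'] s m' 4 by simp
  qed
qed


subsection \<open>Sliding a point along its edge\<close>

abbreviation vertex_count :: "real \<Rightarrow> real \<Rightarrow> nat" where
  "vertex_count s t \<equiv> card {k::nat. s \<le> real k \<and> real k \<le> t}"

lemma finite_vertex_params: "finite {k::nat. s \<le> real k \<and> real k \<le> t}"
proof (rule finite_subset)
  show "{k::nat. s \<le> real k \<and> real k \<le> t} \<subseteq> {..nat \<lfloor>t\<rfloor>}"
    by (auto simp: le_nat_floor)
qed simp

lemma vertex_count_mono:
  assumes "\<And>k::nat. s \<le> real k \<Longrightarrow> real k \<le> t \<Longrightarrow> s' \<le> real k \<and> real k \<le> t'"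
  shows "vertex_count s t \<le> vertex_count s' t'"
  using assms by (intro card_mono finite_vertex_params) auto

lemma vertex_count_le_1:
  assumes "real m \<le> s" "t < real m + 1"
  shows "vertex_count s t \<le> 1"
proof -
  have "{k::nat. s \<le> real k \<and> real k \<le> t} \<subseteq> {m}"
  proof
    fix k
    assume "k \<in> {k::nat. s \<le> real k \<and> real k \<le> t}"
    then have "real m \<le> real k" "real k < real m + 1" using assms by auto
    then show "k \<in> {m}" by simp
  qed
  from card_mono[OF _ this] show ?thesis by simp
qed

lemma vertex_count_shift:
  assumes "0 \<le> s"
  shows "vertex_count (s + real N) (t + real N) = vertex_count s t"
proof -
  have "{k::nat. s + real N \<le> real k \<and> real k \<le> t + real N}
        = (\<lambda>k. k + N) ` {k::nat. s \<le> real k \<and> real k \<le> t}" (is "?L = ?R")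
  proof
    show "?L \<subseteq> ?R"
    proof
      fix k
      assume k: "k \<in> ?L"
      then have "N \<le> k" using assms by auto
      with k show "k \<in> ?R"
        by (intro image_eqI[where x = "k - N"]) auto
    qed
  qed auto
  then show ?thesis
    by (simp add: card_image)
qed

lemma arc_counts_commute: "arc_counts nxt p q = arc_counts nxt q p"
  unfolding arc_counts_def by (intro Collect_cong ex_cong1) blast

lemma vertex_count_in_arc_counts:
  assumes "0 \<le> s" "s \<le> t" "t < s + real (card (orbit nxt i))"
    and "walk nxt i s = p \<and> walk nxt i t = q \<or> walk nxt i s = q \<and> walk nxt i t = p"
  shows "vertex_count s t \<in> arc_counts nxt p q"
  using assms unfolding arc_counts_def by blast

lemma vb_ge_iff: "vb nxt p q \<ge> ereal c \<longleftrightarrow> (\<forall>n\<in>arc_counts nxt p q. c \<le> real n)"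
  unfolding vb_def by (simp add: le_INF_iff)

lemma vb_commute: "vb nxt p q = vb nxt q p"
  unfolding vb_def by (simp add: arc_counts_commute)

text \<open>Let \<open>p\<close> lie in an open edge and \<open>p'\<close> in the closed edge. Moving the end \<open>p'\<close> of an arc to
  \<open>p\<close> does not add vertices, since only the end vertices of the edge can be crossed and those are
  counted already when \<open>p'\<close> sits on them. The result is an arc from \<open>p\<close> unless the move
  passes the other end of the arc (in either direction around the component); in that case \<open>q\<close>
  lies on the same edge and another arc joining \<open>p\<close> and \<open>q\<close> has at most one vertex, against the barrier \<open>c > 1\<close>.\<close>

lemma vb_ge_slide:
  assumes "bij nxt" and card: "\<And>i. 3 \<le> card (orbit nxt i)" and "1 < c"
    and a: "0 < a" "a < 1" and b: "0 \<le> b" "b \<le> 1"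
    and vb: "vb nxt (edge_point nxt k a) q \<ge> ereal c"
  shows "vb nxt (edge_point nxt k b) q \<ge> ereal c"
  unfolding vb_ge_iff
proof
  let ?p = "edge_point nxt k a" and ?p' = "edge_point nxt k b"
  have ge: "c \<le> real n" if "n \<in> arc_counts nxt ?p q" for n
    using vb that unfolding vb_ge_iff by blast
  fix n
  assume "n \<in> arc_counts nxt ?p' q"
  then obtain i s\<^sub>0 t\<^sub>0 where n: "n = vertex_count s\<^sub>0 t\<^sub>0"
    and st\<^sub>0: "0 \<le> s\<^sub>0" "s\<^sub>0 \<le> t\<^sub>0" "t\<^sub>0 < s\<^sub>0 + real (card (orbit nxt i))"
    and w\<^sub>0: "walk nxt i s\<^sub>0 = ?p' \<and> walk nxt i t\<^sub>0 = q \<or> walk nxt i s\<^sub>0 = q \<and> walk nxt i t\<^sub>0 = ?p'"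
    unfolding arc_counts_def by blast
  obtain N where N: "0 < N" "(nxt ^^ N) i = i" "N = card (orbit nxt i)"
    using funpow_period[OF \<open>bij nxt\<close>] .
  have "1 \<le> N" using N by simp
  then have N1: "1 \<le> real N" by simp
  \<comment> \<open>One turn around the component makes room for the edge before the starting point.\<close>
  define s t where "s = s\<^sub>0 + real N" and "t = t\<^sub>0 + real N"
  have st: "1 \<le> s" "s \<le> t" "t < s + real N"
    using st\<^sub>0 N1 unfolding s_def t_def N(3)[symmetric] by linarith+
  have n: "n = vertex_count s t"
    using n vertex_count_shift[OF st\<^sub>0(1)] by (simp add: s_def t_def)
  have w: "walk nxt i s = ?p' \<and> walk nxt i t = q \<or> walk nxt i s = q \<and> walk nxt i t = ?p'"
    using w\<^sub>0 st\<^sub>0 walk_period[OF N(2)] by (simp add: s_def t_def)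
  have arc_from: "c \<le> real (vertex_count x y)"
    if "0 \<le> x" "x \<le> y" "y < x + real N" "walk nxt i x = ?p" "walk nxt i y = q" for x y
    using that unfolding N(3) by (intro ge vertex_count_in_arc_counts) blast+
  have arc_to: "c \<le> real (vertex_count x y)"
    if "0 \<le> x" "x \<le> y" "y < x + real N" "walk nxt i x = q" "walk nxt i y = ?p" for x y
    using that unfolding N(3) by (intro ge vertex_count_in_arc_counts) blast+
  have walk_back: "walk nxt i (y - real N) = walk nxt i y" if "real N \<le> y" for y
    using walk_period[OF N(2), of "y - real N"] that by simp
  have short: False if "vertex_count x y \<le> 1" "c \<le> real (vertex_count x y)" for x y
    using that \<open>1 < c\<close> by linarith
  from w show "c \<le> real n"
  proof
    assume w: "walk nxt i s = ?p' \<and> walk nxt i t = q"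
    then obtain m where m: "(nxt ^^ m) i = k" "s = real m + b"
      using walk_eq_edge_pointE[OF \<open>bij nxt\<close> card _ b st(1)] by metis
    have wp: "walk nxt i (real m + a) = ?p"
      using walk_edge_point[of a nxt i m] a m by simp
    show ?thesis
    proof (cases "real m + a \<le> t \<and> t < real m + a + real N")
      case True
      have "c \<le> real (vertex_count (real m + a) t)"
      proof (rule arc_from[OF _ _ _ wp])
        show "0 \<le> real m + a" using a by simp
        show "real m + a \<le> t" "t < real m + a + real N" using True by blast+
        show "walk nxt i t = q" using w by blast
      qed
      also have "vertex_count (real m + a) t \<le> vertex_count s t"
      proof (rule vertex_count_mono)
        fix j :: nat
        assume "real m + a \<le> real j" "real j \<le> t"
        then have "real m < real j" using a by linarith
        then have "m < j" by simp
        then have "real m + 1 \<le> real j" by linarith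
        then show "s \<le> real j \<and> real j \<le> t"
          using m b \<open>real j \<le> t\<close> by simp
      qed
      finally show ?thesis using n by simp
    next
      case False
      then consider "t < real m + a" | "real m + a \<le> t - real N" by linarith
      then show ?thesis
      proof cases
        case 1
        have "c \<le> real (vertex_count t (real m + a))"
        proof (intro arc_to[OF _ _ _ _ wp])
          show "real m + a < t + real N"
            using st m a b N1 by linarith
        qed (use 1 w st in auto)
        with vertex_count_le_1[of m t "real m + a"] short show ?thesis
          using st m a b by force
      next
        case 2
        have "c \<le> real (vertex_count (real m + a) (t - real N))"
        proof (intro arc_from[OF _ _ _ wp])
          show "t - real N < real m + a + real N"
            using st m a b N1 by linarith
        qed (use 2 w a st walk_back[of t] N1 in auto)
        with vertex_count_le_1[of m "real m + a" "t - real N"] short show ?thesis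
          using st m a b by force
      qed
    qed
  next
    assume w: "walk nxt i s = q \<and> walk nxt i t = ?p'"
    then obtain m where m: "(nxt ^^ m) i = k" "t = real m + b"
      using walk_eq_edge_pointE[OF \<open>bij nxt\<close> card _ b, of i t] st by (metis order_trans)
    have wp: "walk nxt i (real m + a) = ?p"
      using walk_edge_point[of a nxt i m] a m by simp
    show ?thesis
    proof (cases "s \<le> real m + a \<and> real m + a < s + real N")
      case True
      have "c \<le> real (vertex_count s (real m + a))"
        using w True st by (intro arc_to[OF _ _ _ _ wp]) auto
      also have "vertex_count s (real m + a) \<le> vertex_count s t"
      proof (rule vertex_count_mono)
        fix j :: nat
        assume "s \<le> real j" "real j \<le> real m + a"
        then have "real j < real (Suc m)" using a by simp
        then have "j < Suc m" by (simp only: of_nat_less_iff)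
        then have "real j \<le> real m" by simp
        then show "s \<le> real j \<and> real j \<le> t"
          using m b \<open>s \<le> real j\<close> by simp
      qed
      finally show ?thesis using n by simp
    next
      case False
      then consider "real m + a < s" | "s + real N \<le> real m + a" by linarith
      then show ?thesis
      proof cases
        case 1
        have "c \<le> real (vertex_count (real m + a) s)"
        proof (intro arc_from[OF _ _ _ wp])
          show "s < real m + a + real N"
            using st m a b N1 by linarith
        qed (use 1 w a in auto)
        moreover have "vertex_count (real m + a) s \<le> 1"
        proof -
          have "{j::nat. real m + a \<le> real j \<and> real j \<le> s} \<subseteq> {Suc m}"
          proof
            fix j
            assume "j \<in> {j::nat. real m + a \<le> real j \<and> real j \<le> s}"
            then have "real m < real j" "real j \<le> real m + 1"
              using a st m b by auto
            then have "m < j" "real j \<le> real (Suc m)" by simp_all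
            then have "j = Suc m" by (simp only: of_nat_le_iff)
            then show "j \<in> {Suc m}" by simp
          qed
          from card_mono[OF _ this] show ?thesis by simp
        qed
        ultimately show ?thesis using short by blast
      next
        case 2
        have "c \<le> real (vertex_count (s + real N) (real m + a))"
        proof (intro arc_to[OF _ _ _ _ wp])
          show "real m + a < s + real N + real N"
            using st m a b N1 by linarith
          show "walk nxt i (s + real N) = q"
            using walk_period[OF N(2), of s] w st by simp
        qed (use 2 st in auto)
        with vertex_count_le_1[of m "s + real N" "real m + a"] short show ?thesis
          using st m a b by force
      qed
    qed
  qed
qed


lemma one_less_pi_div_theta1:
  assumes "l > 0"
  shows "1 < pi / theta1 l"
proof -
  have "0 < arctan (l / 2)" using assms by simp
  moreover have "arctan (l / 2) < pi / 2" by (rule arctan_ubound)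
  ultimately show ?thesis
    unfolding theta1_def by (simp add: field_simps)
qed

lemma VB1_commute: "(p, q) \<in> VB1 nxt l \<longleftrightarrow> (q, p) \<in> VB1 nxt l"
  unfolding VB1_def by (auto simp: vb_commute)

lemma VB1_slide:
  assumes "l > 0" "bij nxt" and card: "\<And>i. 3 \<le> card (orbit nxt i)"
    and z: "(edge_point nxt k a, q) \<in> VB1 nxt l" and a: "0 < a" "a < 1"
  shows "edge_points nxt k \<times> {q} \<subseteq> VB1 nxt l"
proof clarify
  fix p'
  assume p': "p' \<in> edge_points nxt k"
  then obtain b where b: "p' = edge_point nxt k b" "0 \<le> b" "b \<le> 1"
    by (auto simp: edge_points_eq)
  have "p' \<in> polygon_points nxt"
    using p' unfolding polygon_points_def by blast
  with z show "(p', q) \<in> VB1 nxt l"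
    using vb_ge_slide[OF assms(2) card one_less_pi_div_theta1[OF assms(1)] a b(2,3)] b(1)
    unfolding VB1_def by auto
qed


subsection \<open>The cell decomposition\<close>

text \<open>A vertex barrier may leave a pair of edges only some of its sides or corners, for
  example a vertex opposite an edge, or two vertices. Hence cells are products of faces of any
  dimension.\<close>

definition faces :: "('n::finite \<Rightarrow> 'n) \<Rightarrow> (real^'n) set set" where
  "faces nxt = range (\<lambda>i. {axis i 1}) \<union> range (edge_points nxt)"

definition cells :: "('n::finite \<Rightarrow> 'n) \<Rightarrow> real \<Rightarrow> ((real^'n) \<times> (real^'n)) set set" where
  "cells nxt l = {C \<in> (\<lambda>(F, G). F \<times> G) ` (faces nxt \<times> faces nxt). C \<subseteq> VB1 nxt l}"

lemma finite_cells: "finite (cells nxt l)"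
  unfolding cells_def faces_def by simp

lemma compact_convex_face:
  assumes "F \<in> faces nxt"
  shows "compact F" "convex F"
  using assms unfolding faces_def edge_points_def by auto

lemma cell_properties:
  assumes "C \<in> cells nxt l"
  shows "compact C" "convex C" "C \<subseteq> VB1 nxt l"
  using assms compact_convex_face unfolding cells_def
  by (auto intro!: compact_Times convex_Times)

lemma face_subset_edge_points:
  assumes "F \<in> faces nxt"
  shows "\<exists>i. F \<subseteq> edge_points nxt i"
  using assms unfolding faces_def edge_points_def by auto

lemma cell_subset_edges:
  assumes "C \<in> cells nxt l"
  shows "\<exists>i j. C \<subseteq> edge_points nxt i \<times> edge_points nxt j"
proof -
  obtain F G where FG: "F \<in> faces nxt" "G \<in> faces nxt" "C = F \<times> G"
    using assms unfolding cells_def by auto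
  with face_subset_edge_points show ?thesis
    by (meson Sigma_mono)
qed

lemma VB1_face:
  assumes "l > 0" "bij nxt" and card: "\<And>i. 3 \<le> card (orbit nxt i)"
    and p: "p \<in> polygon_points nxt"
  obtains F where "F \<in> faces nxt" "p \<in> F"
    "\<And>q. (p, q) \<in> VB1 nxt l \<Longrightarrow> F \<times> {q} \<subseteq> VB1 nxt l"
proof -
  obtain k a where ka: "p = edge_point nxt k a" "0 \<le> a" "a \<le> 1"
    using p unfolding polygon_points_def edge_points_eq by auto
  show thesis
  proof (cases "0 < a \<and> a < 1")
    case True
    show thesis
    proof (rule that[of "edge_points nxt k"])
      show "edge_points nxt k \<times> {q} \<subseteq> VB1 nxt l" if "(p, q) \<in> VB1 nxt l" for q
        using VB1_slide[OF assms(1,2) card, of k a q] that ka True by auto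
    qed (use ka in \<open>auto simp: faces_def edge_points_eq\<close>)
  next
    case False
    then have "p = axis k 1 \<or> p = axis (nxt k) 1"
      using ka by (cases "a = 0") auto
    then show thesis
      by (intro that[of "{p}"]) (auto simp: faces_def)
  qed
qed

text \<open>Whether a pair keeps the required number of vertices away depends only on the open faces of
  its two points, and passing to the closed faces can only raise the count.\<close>

lemma VB1_eq_Union_cells:
  assumes "l > 0" "bij nxt" and card: "\<And>i. 3 \<le> card (orbit nxt i)"
  shows "VB1 nxt l = \<Union> (cells nxt l)"
proof
  show "VB1 nxt l \<subseteq> \<Union> (cells nxt l)"
  proof clarify
    fix p q
    assume z: "(p, q) \<in> VB1 nxt l"
    then have "p \<in> polygon_points nxt" "q \<in> polygon_points nxt"
      by (auto simp: VB1_def)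
    then obtain F G where F: "F \<in> faces nxt" "p \<in> F"
        "\<And>q. (p, q) \<in> VB1 nxt l \<Longrightarrow> F \<times> {q} \<subseteq> VB1 nxt l"
      and G: "G \<in> faces nxt" "q \<in> G"
        "\<And>p. (q, p) \<in> VB1 nxt l \<Longrightarrow> G \<times> {p} \<subseteq> VB1 nxt l"
      using VB1_face[OF assms] by metis
    have "F \<times> G \<subseteq> VB1 nxt l"
    proof clarify
      fix p' q'
      assume "p' \<in> F" "q' \<in> G"
      then have "(p', q) \<in> VB1 nxt l" using F(3)[OF z] by blast
      then have "(q', p') \<in> VB1 nxt l"
        using G(3)[of p'] \<open>q' \<in> G\<close> VB1_commute by blast
      then show "(p', q') \<in> VB1 nxt l" using VB1_commute by blast
    qed
    then have "F \<times> G \<in> cells nxt l"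
      using F(1) G(1) unfolding cells_def by auto
    then show "(p, q) \<in> \<Union> (cells nxt l)"
      using F(2) G(2) by blast
  qed
qed (use cell_properties(3) in blast)

lemma compact_VB1:
  assumes "l > 0" "bij nxt" "\<And>i. 3 \<le> card (orbit nxt i)"
  shows "compact (VB1 nxt l)"
  unfolding VB1_eq_Union_cells[OF assms]
  by (intro compact_Union finite_cells) (rule cell_properties(1))

text \<open>First one point slides along its edge, then the other.\<close>

lemma VB1_open_edges:
  assumes "l > 0" "bij nxt" and card: "\<And>i. 3 \<le> card (orbit nxt i)"
    and z: "(edge_point nxt i a, edge_point nxt j b) \<in> VB1 nxt l"
    and "0 < a" "a < 1" "0 < b" "b < 1"
  shows "edge_points nxt i \<times> edge_points nxt j \<subseteq> VB1 nxt l"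
proof clarify
  fix p q
  assume "p \<in> edge_points nxt i" "q \<in> edge_points nxt j"
  then have "(p, edge_point nxt j b) \<in> VB1 nxt l"
    using VB1_slide[OF assms(1-4)] assms by blast
  then have "(q, p) \<in> VB1 nxt l"
    using VB1_slide[OF assms(1-3), of j b p] \<open>q \<in> edge_points nxt j\<close> assms VB1_commute by blast
  then show "(p, q) \<in> VB1 nxt l"
    using VB1_commute by blast
qed


section \<open>Separation of pairs\<close>

definition displacement :: "real^3^'n::finite \<Rightarrow> (real^'n) \<times> (real^'n) \<Rightarrow> real^3" where
  "displacement V z = position V (fst z) - position V (snd z)"

lemma separation_eq_norm: "separation V z = norm (displacement V z)"
  unfolding separation_def displacement_def dist_norm ..

lemma position_scaleR_add:
  "position V (a *\<^sub>R p + b *\<^sub>R q) = a *\<^sub>R position V p + b *\<^sub>R position V q"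
  unfolding position_def by (simp add: scaleR_add_left sum.distrib scaleR_sum_right)

lemma displacement_combination:
  "displacement V (a *\<^sub>R z + b *\<^sub>R z') = a *\<^sub>R displacement V z + b *\<^sub>R displacement V z'"
  unfolding displacement_def by (simp add: position_scaleR_add algebra_simps)

lemma displacement_variation:
  "displacement (U + t *\<^sub>R W) z = displacement U z + t *\<^sub>R displacement W z"
  unfolding displacement_def position_def
  by (simp add: scaleR_add_right sum.distrib scaleR_sum_right sum_subtractf algebra_simps)

lemma linear_displacement: "linear (displacement V)"
proof (rule linearI)
  show "displacement V (x + y) = displacement V x + displacement V y" for x y
    using displacement_combination[of V 1 x 1 y] by simp
  show "displacement V (c *\<^sub>R x) = c *\<^sub>R displacement V x" for c x
    using displacement_combination[of V c x 0 x] by simp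
qed

lemma linear_displacement_vertices: "linear (\<lambda>U. displacement U z)"
  unfolding displacement_def position_def
  by (rule linearI) (simp_all add: algebra_simps sum.distrib scaleR_sum_right sum_subtractf)

lemma continuous_on_displacement [continuous_intros]: "continuous_on S (displacement V)"
  by (intro linear_continuous_on linear_conv_bounded_linear[THEN iffD1] linear_displacement)

lemma continuous_on_separation [continuous_intros]: "continuous_on S (separation V)"
  unfolding separation_eq_norm by (intro continuous_intros)

lemma separation_convex:
  assumes "0 \<le> t" "t \<le> 1"
  shows "separation V ((1 - t) *\<^sub>R z + t *\<^sub>R z') \<le> (1 - t) * separation V z + t * separation V z'"
  unfolding separation_eq_norm displacement_combination
  using assms by (intro order_trans[OF norm_triangle_ineq]) simp

lemma separation_differentiable:
  assumes "separation V z \<noteq> 0"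
  shows "(\<lambda>U. separation U z / 2) differentiable (at V)"
proof -
  have "(\<lambda>U. displacement U z) differentiable (at V)"
    by (intro bounded_linear_imp_differentiable linear_conv_bounded_linear[THEN iffD1]
        linear_displacement_vertices)
  moreover have "norm differentiable (at (displacement V z))"
    using assms by (intro differentiable_norm_at) (auto simp: separation_eq_norm)
  ultimately have "(\<lambda>U. separation U z) differentiable (at V)"
    unfolding separation_eq_norm
    using differentiable_chain_at[of "\<lambda>U. displacement U z" V norm] by (simp add: o_def)
  from differentiable_cmult_left_iff[of "1/2" "\<lambda>U. separation U z" V] this show ?thesis
    by simp
qed

text \<open>The separation of a fixed pair is a convex function of the vertices, so its graph lies
  above its tangents. This holds for all pairs at once.\<close>

lemma separation_variation_ge:
  assumes "separation V z \<noteq> 0"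
  shows "separation V z + t * (displacement V z \<bullet> displacement W z / separation V z)
         \<le> separation (V + t *\<^sub>R W) z"
proof -
  let ?d = "displacement V z" and ?w = "displacement W z"
  have pos: "0 < norm ?d" using assms by (simp add: separation_eq_norm)
  have "norm ?d * norm ?d + t * (?d \<bullet> ?w) = ?d \<bullet> (?d + t *\<^sub>R ?w)"
    by (simp add: inner_add_right power2_norm_eq_inner flip: power2_eq_square)
  also have "\<dots> \<le> norm ?d * norm (?d + t *\<^sub>R ?w)"
    by (rule norm_cauchy_schwarz)
  finally show ?thesis
    using pos unfolding separation_eq_norm displacement_variation by (simp add: field_simps)
qed

text \<open>The convexity estimate for \<open>W\<close> and for \<open>- W\<close> bounds the directional derivative from both
  sides.\<close>

lemma gradient_separation:
  assumes "separation V z \<noteq> 0"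
  shows "gradient (\<lambda>U. separation U z / 2) V \<bullet> W
         = displacement V z \<bullet> displacement W z / (2 * separation V z)"
proof -
  let ?D = "displacement V z \<bullet> displacement W z / (2 * separation V z)"
  have D: "((\<lambda>t. (separation (V + t *\<^sub>R X) z / 2 - separation V z / 2) / t)
      \<longlongrightarrow> gradient (\<lambda>U. separation U z / 2) V \<bullet> X) (at_right 0)" for X
    by (rule difference_quotient_tendsto_gradient[OF separation_differentiable[OF assms]])
  have ge: "displacement V z \<bullet> displacement X z / (2 * separation V z)
      \<le> gradient (\<lambda>U. separation U z / 2) V \<bullet> X" for X
  proof (rule tendsto_lowerbound[OF D])
    show "\<forall>\<^sub>F t in at_right 0. displacement V z \<bullet> displacement X z / (2 * separation V z)
        \<le> (separation (V + t *\<^sub>R X) z / 2 - separation V z / 2) / t"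
      unfolding eventually_at_right_field
    proof (intro exI[of _ 1] conjI allI impI)
      fix t :: real
      assume "0 < t" "t < 1"
      with separation_variation_ge[OF assms, of t X]
      show "displacement V z \<bullet> displacement X z / (2 * separation V z)
        \<le> (separation (V + t *\<^sub>R X) z / 2 - separation V z / 2) / t"
        by (simp add: field_simps)
    qed simp
  qed simp
  have "displacement (- W) z = - displacement W z"
    using linear_displacement_vertices linear_neg by blast
  with ge[of W] ge[of "- W"] show ?thesis
    by simp
qed

text \<open>Separation is convex in the pair, so it cannot fall below a local minimum along a segment that
  starts there.\<close>

lemma local_minimum_le:
  assumes "z \<in> local_minima nxt l V" "convex S" "S \<subseteq> VB1 nxt l" "z \<in> S" "x \<in> S"
  shows "separation V z \<le> separation V x"
proof (cases "x = z")
  case False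
  let ?g = "\<lambda>t. (1 - t) *\<^sub>R z + t *\<^sub>R x"
  have "((\<lambda>t. (1 - t) *\<^sub>R z + t *\<^sub>R x) \<longlongrightarrow> (1 - 0) *\<^sub>R z + 0 *\<^sub>R x) (at_right 0)"
    by (intro tendsto_intros)
  moreover have "\<forall>\<^sub>F t in at_right 0. ?g t \<in> VB1 nxt l \<and> ?g t \<noteq> z"
    unfolding eventually_at_right_field
  proof (intro exI[of _ 1] conjI allI impI)
    fix t :: real
    assume t: "0 < t" "t < 1"
    then show "?g t \<in> VB1 nxt l"
      using assms convexD_alt[of S z x t] by auto
    have "?g t - z = t *\<^sub>R (x - z)"
      by (simp add: algebra_simps)
    then show "?g t \<noteq> z"
      using t False by auto
  qed simp
  ultimately have "filterlim ?g (at z within VB1 nxt l) (at_right 0)"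
    unfolding filterlim_at by simp
  moreover have "\<forall>\<^sub>F z' in at z within VB1 nxt l. separation V z \<le> separation V z'"
    using assms(1) unfolding local_minima_def by simp
  ultimately have "\<forall>\<^sub>F t in at_right 0. separation V z \<le> separation V (?g t)"
    unfolding filterlim_iff by blast
  moreover have "\<forall>\<^sub>F t in at_right 0. (0::real) < t \<and> t < 1"
    unfolding eventually_at_right_field by (intro exI[of _ 1]) simp
  ultimately have "\<forall>\<^sub>F t in at_right 0. separation V z \<le> separation V (?g t) \<and> 0 < t \<and> t < 1"
    by (rule eventually_conj)
  from eventually_happens'[OF trivial_limit_at_right_real this] obtain t where t: "separation V z \<le> separation V (?g t)" "0 < t" "t < 1"
    by blast
  then have "separation V z \<le> (1 - t) * separation V z + t * separation V x"
    using separation_convex[of t V z x] by simp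
  then have "t * separation V z \<le> t * separation V x"
    by (simp add: algebra_simps)
  with t show ?thesis by simp
qed simp


section \<open>Bounds on the constraint thickness\<close>

lemma turning_angle_bounds:
  shows "0 \<le> turning_angle nxt V i" "turning_angle nxt V i \<le> pi"
    and "cos (turning_angle nxt V i) = edge nxt V (inv nxt i) \<bullet> edge nxt V i
           / (norm (edge nxt V (inv nxt i)) * norm (edge nxt V i))"
proof -
  let ?e = "edge nxt V (inv nxt i)" and ?e' = "edge nxt V i"
  have "\<bar>(?e \<bullet> ?e') / (norm ?e * norm ?e')\<bar> \<le> 1"
    using Cauchy_Schwarz_ineq2[of ?e ?e']
    by (cases "?e = 0 \<or> ?e' = 0") (auto simp: divide_le_eq_1_pos abs_mult)
  then have "-1 \<le> (?e \<bullet> ?e') / (norm ?e * norm ?e')" "(?e \<bullet> ?e') / (norm ?e * norm ?e') \<le> 1"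
    by linarith+
  then show "0 \<le> turning_angle nxt V i" "turning_angle nxt V i \<le> pi"
    "cos (turning_angle nxt V i) = (?e \<bullet> ?e') / (norm ?e * norm ?e')"
    unfolding turning_angle_def Let_def
    by (auto intro: arccos_lbound arccos_ubound)
qed

lemma tan_half_turning_angle_nonneg: "0 \<le> tan (turning_angle nxt V i / 2)"
proof (cases "turning_angle nxt V i = pi")
  case True
  then show ?thesis by simp
next
  case False
  then have "turning_angle nxt V i / 2 < pi / 2"
    using turning_angle_bounds(2)[of nxt V i] by simp
  then show ?thesis
    using turning_angle_bounds(1)[of nxt V i]
    by (cases "turning_angle nxt V i = 0") (auto intro!: less_imp_le tan_gt_zero)
qed

lemma min_rad_side_nonneg: "0 \<le> min_rad_side nxt i s V"
  unfolding min_rad_side_def using tan_half_turning_angle_nonneg[of nxt V i] by simp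

abbreviation thickness_values :: "('n::finite \<Rightarrow> 'n) \<Rightarrow> real \<Rightarrow> real^3^'n \<Rightarrow> real set" where
  "thickness_values nxt l V \<equiv>
     min_rad nxt V ` {i. turning_angle nxt V i \<noteq> 0} \<union> (\<lambda>z. separation V z / 2) ` VB1 nxt l"

lemma CThi_le:
  assumes "x \<in> thickness_values nxt l V"
  shows "CThi nxt l V \<le> x"
  unfolding CThi_def
proof (rule cInf_lower[OF assms])
  have "0 \<le> y" if "y \<in> thickness_values nxt l V" for y
    using that min_rad_side_nonneg by (auto simp: min_rad_def separation_def)
  then show "bdd_below (thickness_values nxt l V)"
    by (rule bdd_belowI)
qed

lemma CThi_le_min_rad_side:
  assumes "turning_angle nxt V i \<noteq> 0"
  shows "CThi nxt l V \<le> min_rad_side nxt i s V"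
proof -
  have "CThi nxt l V \<le> min_rad nxt V i"
    using assms by (intro CThi_le) blast
  also have "\<dots> \<le> min_rad_side nxt i s V"
    unfolding min_rad_def by (cases s) auto
  finally show ?thesis .
qed

lemma CThi_le_separation:
  assumes "z \<in> VB1 nxt l"
  shows "CThi nxt l V \<le> separation V z / 2"
  using assms by (intro CThi_le) blast

section \<open>Contacts and struts of a thick polygon\<close>

lemma finite_segment_endpoints:
  fixes S :: "'a::euclidean_space set"
  shows "finite {u. \<exists>v. S = closed_segment u v}"
proof (cases "\<exists>x y. S = closed_segment x y")
  case True
  then obtain x y where S: "S = closed_segment x y" by blast
  have "{u. \<exists>v. S = closed_segment u v} \<subseteq> {x, y}"
  proof
    fix u
    assume "u \<in> {u. \<exists>v. S = closed_segment u v}"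
    then obtain v where "closed_segment u v = closed_segment x y"
      using S by blast
    then show "u \<in> {x, y}"
      unfolding closed_segment_eq by blast
  qed
  then show ?thesis
    by (rule finite_subset) simp
next
  case False
  then have "{u. \<exists>v. S = closed_segment u v} = {}"
    by blast
  then show ?thesis by simp
qed

locale thick_polygon =
  fixes nxt :: "'n::finite \<Rightarrow> 'n" and l :: real and V :: "real^3^'n"
  assumes l_pos: "l > 0"
    and closed_polygon: "closed_polygon nxt V"
    and thick: "CThi nxt l V \<ge> 1"
begin

lemma bij_nxt: "bij nxt"
  and card_orbit: "3 \<le> card (orbit nxt i)"
  and edge_nonzero: "edge nxt V i \<noteq> 0"
  using closed_polygon unfolding closed_polygon_def by blast+

lemmas polygon_assms = l_pos bij_nxt card_orbit

lemma separation_ge_2: "z \<in> VB1 nxt l \<Longrightarrow> 2 \<le> separation V z"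
  using CThi_le_separation[of z nxt l V] thick by simp

definition contacts :: "((real^'n) \<times> (real^'n)) set" where
  "contacts = {z \<in> VB1 nxt l. separation V z = 2}"

lemma contactsI:
  assumes "z \<in> VB1 nxt l" "separation V z \<le> 2"
  shows "z \<in> contacts"
  using assms separation_ge_2[of z] by (simp add: contacts_def)

lemma contacts_subset_local_minima: "contacts \<subseteq> local_minima nxt l V"
proof
  fix z
  assume z: "z \<in> contacts"
  then have "\<forall>z'\<in>VB1 nxt l. separation V z \<le> separation V z'"
    using separation_ge_2 by (simp add: contacts_def)
  then show "z \<in> local_minima nxt l V"
    using z unfolding local_minima_def contacts_def
    by (auto simp: eventually_at_filter)
qed

text \<open>Two displacements of minimal length whose mean is no shorter are equal, as the Euclidean
  norm is strictly convex.\<close>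

lemma displacement_contacts_eq:
  assumes "x \<in> contacts" "y \<in> contacts" "convex S" "S \<subseteq> VB1 nxt l" "x \<in> S" "y \<in> S"
  shows "displacement V x = displacement V y"
proof -
  let ?a = "displacement V x" and ?b = "displacement V y"
  have "(1/2) *\<^sub>R x + (1/2) *\<^sub>R y \<in> S"
    using assms by (intro convexD) auto
  then have "2 \<le> norm ((1/2) *\<^sub>R ?a + (1/2) *\<^sub>R ?b)"
    using separation_ge_2[of "(1/2) *\<^sub>R x + (1/2) *\<^sub>R y"] assms(4)
    unfolding separation_eq_norm displacement_combination by blast
  also have "\<dots> = norm (?a + ?b) / 2"
    by (simp flip: scaleR_add_right)
  finally have "4\<^sup>2 \<le> (norm (?a + ?b))\<^sup>2"
    by (intro power_mono) auto
  moreover have "norm ?a = 2" "norm ?b = 2"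
    using assms by (auto simp: contacts_def separation_eq_norm)
  moreover have "(norm (?a + ?b))\<^sup>2 + (norm (?a - ?b))\<^sup>2 = 2 * (norm ?a)\<^sup>2 + 2 * (norm ?b)\<^sup>2"
    by (simp add: power2_norm_eq_inner inner_add inner_diff inner_commute)
  ultimately have "(norm (?a - ?b))\<^sup>2 \<le> 2 * 2\<^sup>2 + 2 * 2\<^sup>2 - 4\<^sup>2"
    by (simp only:)
  then show ?thesis by simp
qed

text \<open>Inside a convex part of the region, contacts all have the same displacement, and
  displacement is affine.\<close>

lemma convex_contacts:
  assumes "convex S" "S \<subseteq> VB1 nxt l"
  shows "convex (contacts \<inter> S)"
proof (rule convexI)
  fix x y and u v :: real
  assume x: "x \<in> contacts \<inter> S" and y: "y \<in> contacts \<inter> S" and uv: "0 \<le> u" "0 \<le> v" "u + v = 1"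
  then have mem: "u *\<^sub>R x + v *\<^sub>R y \<in> S"
    using assms(1) by (intro convexD) auto
  have "displacement V x = displacement V y"
    using displacement_contacts_eq[OF _ _ assms] x y by blast
  then have "displacement V (u *\<^sub>R x + v *\<^sub>R y) = displacement V x"
    using uv by (simp add: displacement_combination flip: scaleR_add_left)
  then have "separation V (u *\<^sub>R x + v *\<^sub>R y) = 2"
    using x by (simp add: separation_eq_norm contacts_def)
  then show "u *\<^sub>R x + v *\<^sub>R y \<in> contacts \<inter> S"
    using mem assms(2) by (auto simp: contacts_def)
qed

lemma position_edge_point: "position V (edge_point nxt k a) = V $ k + a *\<^sub>R edge nxt V k"
proof -
  have axis: "position V (axis j 1) = V $ j" for j
    unfolding position_def axis_def by (simp add: if_distrib[of "\<lambda>c. c *\<^sub>R _"] cong: if_cong)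
  show ?thesis
    unfolding edge_point_def position_scaleR_add axis edge_def by (simp add: algebra_simps)
qed

text \<open>When two points slide along two edges with constant displacement, the edges are parallel
  and the parameters move at a fixed ratio. Being in motion both points meet the open edges, so
  the whole product of the edges lies beyond the vertex barrier.\<close>

lemma contacts_on_edges:
  assumes z: "z \<in> contacts" and w: "w \<in> contacts" and "z \<noteq> w"
    and segment: "closed_segment z w \<subseteq> VB1 nxt l"
    and zQ: "z \<in> edge_points nxt i \<times> edge_points nxt j"
    and wQ: "w \<in> edge_points nxt i \<times> edge_points nxt j"
  obtains a b where "0 < a" "a < 1" "0 < b" "b < 1"
    "(edge_point nxt i a, edge_point nxt j b) \<in> contacts"
    "parallel_edges nxt V i j"
    "edge_points nxt i \<times> edge_points nxt j \<subseteq> VB1 nxt l"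
    "collinear (contacts \<inter> edge_points nxt i \<times> edge_points nxt j)"
proof -
  let ?P = "edge_point nxt i" and ?P' = "edge_point nxt j"
  let ?Q = "edge_points nxt i \<times> edge_points nxt j"
  let ?e = "edge nxt V i" and ?e' = "edge nxt V j"
  have disp: "(a - a') *\<^sub>R ?e = (b - b') *\<^sub>R ?e'"
    if "displacement V (?P a, ?P' b) = displacement V (?P a', ?P' b')" for a a' b b'
    using that by (simp add: displacement_def position_edge_point algebra_simps)
  obtain a\<^sub>1 b\<^sub>1 where ab\<^sub>1: "z = (?P a\<^sub>1, ?P' b\<^sub>1)" "0 \<le> a\<^sub>1" "a\<^sub>1 \<le> 1" "0 \<le> b\<^sub>1" "b\<^sub>1 \<le> 1"
    using zQ by (auto simp: edge_points_eq)
  obtain a\<^sub>2 b\<^sub>2 where ab\<^sub>2: "w = (?P a\<^sub>2, ?P' b\<^sub>2)" "0 \<le> a\<^sub>2" "a\<^sub>2 \<le> 1" "0 \<le> b\<^sub>2" "b\<^sub>2 \<le> 1"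
    using wQ by (auto simp: edge_points_eq)
  have "displacement V z = displacement V w"
    by (rule displacement_contacts_eq[OF z w convex_closed_segment segment]) auto
  then have eq: "(a\<^sub>1 - a\<^sub>2) *\<^sub>R ?e = (b\<^sub>1 - b\<^sub>2) *\<^sub>R ?e'"
    using disp ab\<^sub>1 ab\<^sub>2 by simp
  have neq: "a\<^sub>1 \<noteq> a\<^sub>2" "b\<^sub>1 \<noteq> b\<^sub>2"
    using eq \<open>z \<noteq> w\<close> ab\<^sub>1(1) ab\<^sub>2(1) edge_nonzero by auto
  define c where "c = (a\<^sub>1 - a\<^sub>2) / (b\<^sub>1 - b\<^sub>2)"
  have "?e' = (1 / (b\<^sub>1 - b\<^sub>2)) *\<^sub>R ((b\<^sub>1 - b\<^sub>2) *\<^sub>R ?e')"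
    using neq by simp
  also have "\<dots> = c *\<^sub>R ?e"
    by (simp add: c_def flip: eq)
  finally have c: "?e' = c *\<^sub>R ?e" .
  define a b where "a = (a\<^sub>1 + a\<^sub>2) / 2" and "b = (b\<^sub>1 + b\<^sub>2) / 2"
  have ab: "0 < a" "a < 1" "0 < b" "b < 1"
    using neq ab\<^sub>1 ab\<^sub>2 by (auto simp: a_def b_def)
  have mid: "(?P a, ?P' b) = (1/2) *\<^sub>R z + (1/2) *\<^sub>R w"
    unfolding ab\<^sub>1(1) ab\<^sub>2(1) a_def b_def
    by (simp add: edge_point_def vec_eq_iff field_simps)
  have "convex (contacts \<inter> closed_segment z w)"
    by (rule convex_contacts[OF convex_closed_segment segment])
  then have "(?P a, ?P' b) \<in> contacts \<inter> closed_segment z w"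
    unfolding mid using z w by (intro convexD) auto
  then have mid_contact: "(?P a, ?P' b) \<in> contacts"
    by blast
  have Q: "?Q \<subseteq> VB1 nxt l"
    using VB1_open_edges[OF polygon_assms _ ab] mid_contact by (simp add: contacts_def)
  have "convex ?Q"
    unfolding edge_points_def by (intro convex_Times convex_closed_segment)
  define dir where "dir = (c *\<^sub>R (axis (nxt i) 1 - axis i (1::real)), axis (nxt j) 1 - axis j (1::real))"
  have "\<exists>r. x - y = r *\<^sub>R dir" if x: "x \<in> contacts \<inter> ?Q" and y: "y \<in> contacts \<inter> ?Q" for x y
  proof -
    obtain a b where x': "x = (?P a, ?P' b)"
      using x by (auto simp: edge_points_eq)
    obtain a' b' where y': "y = (?P a', ?P' b')"
      using y by (auto simp: edge_points_eq)
    have "displacement V x = displacement V y"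
      using displacement_contacts_eq[OF _ _ \<open>convex ?Q\<close> Q] x y by blast
    then have "(a - a') *\<^sub>R ?e = ((b - b') * c) *\<^sub>R ?e"
      using disp x' y' c by simp
    then have "a - a' = (b - b') * c"
      using edge_nonzero by simp
    moreover have "?P a - ?P a' = (a - a') *\<^sub>R (axis (nxt i) 1 - axis i 1)"
      "?P' b - ?P' b' = (b - b') *\<^sub>R (axis (nxt j) 1 - axis j 1)"
      unfolding edge_point_def by (simp_all add: algebra_simps)
    ultimately have "x - y = (b - b') *\<^sub>R dir"
      unfolding x' y' dir_def by simp
    then show ?thesis by blast
  qed
  then have "collinear (contacts \<inter> ?Q)"
    unfolding collinear_def by blast
  with that[OF ab mid_contact _ Q] c show thesis
    unfolding parallel_edges_def by blast
qed

text \<open>The contacts on two such edges form a collinear compact convex set, that is, a segment. It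
  is a maximal interval of local minima: a larger one would again consist of contacts, because it
  contains one and separation is convex along it, and it would lie on the same two edges, because
  it meets their interiors.\<close>

lemma contact_interval:
  assumes z: "z \<in> contacts" and w: "w \<in> contacts" and "z \<noteq> w"
    and segment: "closed_segment z w \<subseteq> VB1 nxt l"
    and zQ: "z \<in> edge_points nxt i \<times> edge_points nxt j"
    and wQ: "w \<in> edge_points nxt i \<times> edge_points nxt j"
  obtains u v where "contacts \<inter> edge_points nxt i \<times> edge_points nxt j = closed_segment u v"
    "minima_interval nxt l V u v" "family_endpoint nxt l V u" "family_endpoint nxt l V v"
proof -
  let ?Q = "edge_points nxt i \<times> edge_points nxt j"
  obtain a b where ab: "0 < a" "a < 1" "0 < b" "b < 1"
    and mid: "(edge_point nxt i a, edge_point nxt j b) \<in> contacts"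
    and parallel: "parallel_edges nxt V i j"
    and Q: "?Q \<subseteq> VB1 nxt l"
    and collinear: "collinear (contacts \<inter> ?Q)"
    by (rule contacts_on_edges[OF assms])
  have "compact ?Q" "convex ?Q"
    unfolding edge_points_def
    by (intro compact_Times compact_segment convex_Times convex_closed_segment)+
  have "closed {x. separation V x = 2}"
    by (intro closed_Collect_eq continuous_intros)
  then have "compact (?Q \<inter> {x. separation V x = 2})"
    using \<open>compact ?Q\<close> by (rule compact_Int_closed[rotated])
  also have "?Q \<inter> {x. separation V x = 2} = contacts \<inter> ?Q"
    using Q by (auto simp: contacts_def)
  finally have "compact (contacts \<inter> ?Q)" .
  moreover have "convex (contacts \<inter> ?Q)"
    by (rule convex_contacts[OF \<open>convex ?Q\<close> Q])
  moreover have "contacts \<inter> ?Q \<noteq> {}" using z zQ by blast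
  ultimately obtain u v where uv: "contacts \<inter> ?Q = closed_segment u v"
    using compact_convex_collinear_segment collinear by metis
  have "u \<noteq> v"
    using \<open>z \<noteq> w\<close> uv z zQ w wQ by (metis IntI closed_segment_idem singletonD)
  moreover have "closed_segment u v \<subseteq> local_minima nxt l V"
    using uv contacts_subset_local_minima by blast
  moreover have "closed_segment u v \<subseteq> ?Q"
    using uv by blast
  ultimately have interval: "minima_interval nxt l V u v"
    using parallel unfolding minima_interval_def by blast
  have maximal: "closed_segment x y = closed_segment u v"
    if xy: "minima_interval nxt l V x y" and sub: "closed_segment u v \<subseteq> closed_segment x y" for x y
  proof -
    let ?S = "closed_segment x y"
    obtain i' j' where S: "?S \<subseteq> local_minima nxt l V"
      and S': "?S \<subseteq> edge_points nxt i' \<times> edge_points nxt j'"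
      using xy unfolding minima_interval_def by blast
    have VB1: "?S \<subseteq> VB1 nxt l"
      using S by (auto simp: local_minima_def)
    have contacts: "?S \<subseteq> contacts"
    proof
      fix s
      assume s: "s \<in> ?S"
      have u: "u \<in> contacts" "u \<in> ?S" using uv sub by auto
      then have "separation V s \<le> separation V u"
        using S s by (intro local_minimum_le[OF _ convex_closed_segment VB1]) auto
      then have "separation V s \<le> 2"
        using u by (simp add: contacts_def)
      with VB1 s show "s \<in> contacts"
        by (blast intro: contactsI)
    qed
    have "(edge_point nxt i a, edge_point nxt j b) \<in> ?Q"
      using ab by (auto simp: edge_points_eq)
    then have "(edge_point nxt i a, edge_point nxt j b) \<in> edge_points nxt i' \<times> edge_points nxt j'"
      using mid uv sub S' by blast
    then obtain a' b' where "edge_point nxt i a = edge_point nxt i' a'"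
      "edge_point nxt j b = edge_point nxt j' b'"
      by (auto simp: edge_points_eq)
    then have "i = i'" "j = j'"
      using edge_point_inj(1)[OF card_orbit] ab by blast+
    then show ?thesis
      using contacts S' uv sub by blast
  qed
  have "family_endpoint nxt l V u"
    using interval maximal unfolding family_endpoint_def by blast
  moreover have "family_endpoint nxt l V v"
    unfolding family_endpoint_def
  proof (intro exI[of _ u] conjI allI impI)
    show "minima_interval nxt l V v u"
      using interval unfolding minima_interval_def closed_segment_commute[of v u] by blast
  qed (use maximal in \<open>simp add: closed_segment_commute\<close>)
  ultimately show thesis
    using that uv interval by blast
qed

text \<open>At a contact that is not isolated, other local minima accumulate. One of them
  shares a cell with it, which makes it a contact too, and the two span an interval of contacts
  with constant displacement.\<close>

lemma contact_between_struts:
  assumes z: "z \<in> contacts"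
  obtains u v where "u \<in> Strut nxt l V" "v \<in> Strut nxt l V" "z \<in> closed_segment u v"
    "displacement V u = displacement V z" "displacement V v = displacement V z"
proof (cases "z isolated_in local_minima nxt l V")
  case True
  then have "z \<in> Strut nxt l V"
    using z by (simp add: Strut_def contacts_def)
  then show thesis using that[of z z] by simp
next
  case False
  let ?T = "- \<Union> {C \<in> cells nxt l. z \<notin> C}"
  have "closed (\<Union> {C \<in> cells nxt l. z \<notin> C})"
    using cell_properties(1) finite_cells[of nxt l]
    by (intro closed_Union) (auto intro: compact_imp_closed)
  then have "open ?T" by (rule open_Compl)
  moreover have "z \<in> ?T" by blast
  moreover have "z islimpt local_minima nxt l V"
    using False z contacts_subset_local_minima by (auto simp: isolated_in_islimpt_iff)
  ultimately obtain w where w: "w \<in> local_minima nxt l V" "w \<in> ?T" "w \<noteq> z"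
    unfolding islimpt_def by blast
  have "w \<in> \<Union> (cells nxt l)"
    using w(1) VB1_eq_Union_cells[OF polygon_assms] by (auto simp: local_minima_def)
  then obtain C where C: "C \<in> cells nxt l" "w \<in> C" by blast
  then have "z \<in> C" using w(2) by blast
  note C_props = cell_properties[OF C(1)]
  have "separation V w \<le> separation V z"
    by (rule local_minimum_le[OF w(1) C_props(2,3) C(2) \<open>z \<in> C\<close>])
  then have "separation V w \<le> 2"
    using z by (simp add: contacts_def)
  then have w_contact: "w \<in> contacts"
    using C(2) C_props(3) by (blast intro: contactsI)
  obtain i j where Q: "C \<subseteq> edge_points nxt i \<times> edge_points nxt j"
    using cell_subset_edges[OF C(1)] by blast
  have segment: "closed_segment z w \<subseteq> VB1 nxt l"
    using closed_segment_subset[OF \<open>z \<in> C\<close> C(2) C_props(2)] C_props(3) by blast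
  obtain u v where uv: "contacts \<inter> edge_points nxt i \<times> edge_points nxt j = closed_segment u v"
    "family_endpoint nxt l V u" "family_endpoint nxt l V v"
    by (rule contact_interval[OF z w_contact w(3)[symmetric] segment Q[THEN subsetD, OF \<open>z \<in> C\<close>]
          Q[THEN subsetD, OF C(2)]])
  have sub: "closed_segment u v \<subseteq> VB1 nxt l"
    using uv(1) by (auto simp: contacts_def)
  have mem: "z \<in> closed_segment u v" "u \<in> contacts" "v \<in> contacts"
    using uv(1) z Q \<open>z \<in> C\<close> by auto
  then have "u \<in> Strut nxt l V" "v \<in> Strut nxt l V"
    using uv by (simp_all add: Strut_def contacts_def)
  moreover have "displacement V u = displacement V z" "displacement V v = displacement V z"
    using mem z by (auto intro!: displacement_contacts_eq[OF _ _ convex_closed_segment sub])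
  ultimately show thesis
    using that mem(1) by blast
qed

lemma Strut_subset_contacts: "Strut nxt l V \<subseteq> contacts"
  by (auto simp: Strut_def contacts_def)

text \<open>An isolated strut is the only contact of its cell, and all families on a given pair of edges
  are the same segment of contacts.\<close>

lemma finite_Strut: "finite (Strut nxt l V)"
proof (rule finite_subset)
  let ?Q = "\<lambda>i j. edge_points nxt i \<times> edge_points nxt j"
  let ?A = "\<Union>C\<in>cells nxt l. {u. \<exists>v. contacts \<inter> C = closed_segment u v}"
  let ?B = "\<Union>i. \<Union>j. {u. \<exists>v. contacts \<inter> ?Q i j = closed_segment u v}"
  show "finite (?A \<union> ?B)"
    using finite_cells by (intro finite_UnI finite_UN_I finite_segment_endpoints) auto
  show "Strut nxt l V \<subseteq> ?A \<union> ?B"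
  proof
    fix z
    assume strut: "z \<in> Strut nxt l V"
    then have z: "z \<in> contacts" using Strut_subset_contacts by blast
    from strut consider "z isolated_in local_minima nxt l V" | "family_endpoint nxt l V z"
      unfolding Strut_def by blast
    then show "z \<in> ?A \<union> ?B"
    proof cases
      case 1
      have "z \<in> \<Union> (cells nxt l)"
        using z VB1_eq_Union_cells[OF polygon_assms] by (auto simp: contacts_def)
      then obtain C where C: "C \<in> cells nxt l" "z \<in> C" by blast
      have convex: "convex (contacts \<inter> C)"
        using cell_properties(2,3)[OF C(1)] by (rule convex_contacts)
      have "contacts \<inter> C = {z}"
      proof (rule ccontr)
        assume "contacts \<inter> C \<noteq> {z}"
        moreover have "z \<in> contacts \<inter> C"
          using C(2) z by blast
        ultimately have "\<nexists>a. contacts \<inter> C = {a}"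
          by (metis singletonD)
        then have "z islimpt (contacts \<inter> C)"
          using \<open>z \<in> contacts \<inter> C\<close> convex_connected[OF convex] connected_imp_perfect by blast
        then have "z islimpt local_minima nxt l V"
          by (rule islimpt_subset) (use contacts_subset_local_minima in blast)
        with 1 show False
          by (simp add: isolated_in_islimpt_iff)
      qed
      then have "contacts \<inter> C = closed_segment z z" by simp
      then show ?thesis using C(1) by blast
    next
      case 2
      then obtain z' where z': "minima_interval nxt l V z z'"
        and maximal: "\<And>u u'. minima_interval nxt l V u u' \<Longrightarrow>
          closed_segment z z' \<subseteq> closed_segment u u' \<Longrightarrow> closed_segment u u' = closed_segment z z'"
        unfolding family_endpoint_def by blast
      let ?S = "closed_segment z z'"
      obtain i j where "z \<noteq> z'" and S: "?S \<subseteq> local_minima nxt l V" and Q: "?S \<subseteq> ?Q i j"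
        using z' unfolding minima_interval_def by blast
      have VB1: "?S \<subseteq> VB1 nxt l"
        using S by (auto simp: local_minima_def)
      have "separation V z' \<le> separation V z"
        using S by (intro local_minimum_le[OF _ convex_closed_segment VB1]) auto
      then have "separation V z' \<le> 2"
        using z by (simp add: contacts_def)
      then have "z' \<in> contacts"
        using VB1 by (intro contactsI) auto
      then obtain u v where uv: "contacts \<inter> ?Q i j = closed_segment u v"
        "minima_interval nxt l V u v"
        by (rule contact_interval[OF z _ \<open>z \<noteq> z'\<close> VB1 Q[THEN subsetD, OF ends_in_segment(1)]
              Q[THEN subsetD, OF ends_in_segment(2)]])
      have "?S \<subseteq> closed_segment u v"
        using uv(1) z \<open>z' \<in> contacts\<close> Q by (intro closed_segment_subset) auto
      then have "contacts \<inter> ?Q i j = ?S"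
        using maximal uv by simp
      then show ?thesis by blast
    qed
  qed
qed

end


section \<open>Regularity of MinRad\<close>

lemma linear_side_edge: "linear (\<lambda>U. side_edge nxt U i s)"
  by (rule linearI; cases s) (simp_all add: edge_def algebra_simps)

lemma side_edge_differentiable: "(\<lambda>U. side_edge nxt U i s) differentiable F"
proof -
  have "bounded_linear (\<lambda>U. side_edge nxt U i s)"
    using linear_side_edge linear_conv_bounded_linear by blast
  then show ?thesis
    by (rule bounded_linear_imp_differentiable)
qed

definition turning_cos :: "('n::finite \<Rightarrow> 'n) \<Rightarrow> 'n \<Rightarrow> real^3^'n \<Rightarrow> real" where
  "turning_cos nxt i U = side_edge nxt U i Minus \<bullet> side_edge nxt U i Plus
     / (norm (side_edge nxt U i Minus) * norm (side_edge nxt U i Plus))"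

lemma turning_angle_eq_arccos: "turning_angle nxt U i = arccos (turning_cos nxt i U)"
  unfolding turning_angle_def turning_cos_def Let_def by simp

lemma cos_turning_angle: "cos (turning_angle nxt U i) = turning_cos nxt i U"
  unfolding turning_angle_bounds(3) turning_cos_def by simp

lemma turning_cos_bounds: "-1 \<le> turning_cos nxt i U" "turning_cos nxt i U \<le> 1"
  unfolding cos_turning_angle[symmetric] by simp_all

lemma turning_cos_differentiable:
  assumes "\<And>s. side_edge nxt V i s \<noteq> 0"
  shows "turning_cos nxt i differentiable (at V)"
proof -
  have norm: "(\<lambda>U. norm (side_edge nxt U i s)) differentiable (at V)" for s
    using differentiable_compose[OF differentiable_norm_at[OF assms] side_edge_differentiable] .
  have "(\<lambda>U. side_edge nxt U i Minus \<bullet> side_edge nxt U i Plus) differentiable (at V)"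
    using side_edge_differentiable[of nxt i _ "at V"] has_derivative_inner
    unfolding differentiable_def by blast
  then show ?thesis
    unfolding turning_cos_def using norm assms
    by (intro differentiable_divide differentiable_mult) (simp_all del: side_edge.simps)
qed

lemma isCont_turning_angle:
  assumes "\<And>s. side_edge nxt V i s \<noteq> 0"
  shows "isCont (\<lambda>U. turning_angle nxt U i) V"
proof -
  have "turning_cos nxt i \<midarrow>V\<rightarrow> turning_cos nxt i V"
    using differentiable_imp_continuous_within[OF turning_cos_differentiable[OF assms]]
    by (simp add: isCont_def)
  then show ?thesis
    unfolding isCont_def turning_angle_eq_arccos
    by (intro continuous_on_tendsto_compose[OF continuous_on_arccos'])
       (auto simp: turning_cos_bounds intro: always_eventually)
qed

lemma turning_angle_interior:
  assumes "turning_angle nxt V i \<noteq> 0" "turning_angle nxt V i \<noteq> pi"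
  shows "0 < tan (turning_angle nxt V i / 2)" "0 < cos (turning_angle nxt V i / 2)"
    "-1 < turning_cos nxt i V" "turning_cos nxt i V < 1"
proof -
  have angle: "0 < turning_angle nxt V i" "turning_angle nxt V i < pi"
    using assms turning_angle_bounds(1,2)[of nxt V i] by simp_all
  then show "0 < tan (turning_angle nxt V i / 2)" "0 < cos (turning_angle nxt V i / 2)"
    by (simp_all add: tan_gt_zero cos_gt_zero)
  have "turning_cos nxt i V \<noteq> 1" "turning_cos nxt i V \<noteq> -1"
    using assms by (auto simp: turning_angle_eq_arccos)
  then show "-1 < turning_cos nxt i V" "turning_cos nxt i V < 1"
    using turning_cos_bounds[of nxt i V] by simp_all
qed

lemma min_rad_side_differentiable:
  assumes nz: "\<And>s. side_edge nxt V i s \<noteq> 0"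
    and angle: "turning_angle nxt V i \<noteq> 0" "turning_angle nxt V i \<noteq> pi"
  shows "min_rad_side nxt i s differentiable (at V)"
proof -
  note interior = turning_angle_interior[OF angle]
  have "arccos differentiable (at (turning_cos nxt i V))"
    using DERIV_arccos[OF interior(3,4)] real_differentiable_def by blast
  then have "(\<lambda>U. turning_angle nxt U i) differentiable (at V)"
    unfolding turning_angle_eq_arccos
    by (rule differentiable_compose[OF _ turning_cos_differentiable[OF nz]])
  then have half: "(\<lambda>U. turning_angle nxt U i / 2) differentiable (at V)"
    by (intro differentiable_divide) simp_all
  have "tan differentiable (at (turning_angle nxt V i / 2))"
    using DERIV_tan[of "turning_angle nxt V i / 2"] interior(2) real_differentiable_def
    by (metis less_irrefl)
  then have "(\<lambda>U. tan (turning_angle nxt U i / 2)) differentiable (at V)"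
    by (rule differentiable_compose[OF _ half])
  moreover have "(\<lambda>U. norm (side_edge nxt U i s)) differentiable (at V)"
    using differentiable_compose[OF differentiable_norm_at[OF nz] side_edge_differentiable] .
  ultimately show ?thesis
    unfolding min_rad_side_def using interior(1)
    by (intro differentiable_divide differentiable_mult) simp_all
qed

lemma eventually_less_of_tendsto:
  fixes g h :: "'a \<Rightarrow> real"
  assumes "(g \<longlongrightarrow> x) F" "(h \<longlongrightarrow> y) F" "x < y"
  shows "\<forall>\<^sub>F t in F. g t < h t"
proof -
  obtain c where c: "x < c" "c < y"
    using dense[OF assms(3)] by blast
  from order_tendstoD(2)[OF assms(1) c(1)] order_tendstoD(1)[OF assms(2) c(2)] show ?thesis
    by eventually_elim simp
qed

lemma isCont_tendsto_variation:
  fixes g :: "'a::real_normed_vector \<Rightarrow> 'b::topological_space"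
  assumes "isCont g V"
  shows "((\<lambda>t. g (V + t *\<^sub>R W)) \<longlongrightarrow> g V) (at_right 0)"
proof -
  have "((\<lambda>t. V + t *\<^sub>R W) \<longlongrightarrow> V + 0 *\<^sub>R W) (at_right 0)"
    by (intro tendsto_intros)
  then show ?thesis
    using isCont_tendsto_compose[OF assms] by simp
qed

text \<open>If every turning angle vanished, all edges of a component would be positive multiples of one
  vector, and the component could not close up.\<close>

lemma exists_turning_angle_nonzero:
  fixes V :: "real^3^'n::finite"
  assumes "closed_polygon nxt V"
  obtains i where "turning_angle nxt V i \<noteq> 0"
proof (rule ccontr)
  assume "\<not> thesis"
  then have zero: "turning_angle nxt V i = 0" for i using that by blast
  have bij: "bij nxt" and nz: "\<And>i. edge nxt V i \<noteq> 0"
    using assms unfolding closed_polygon_def by blast+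
  have step: "\<exists>c>0. edge nxt V (nxt i) = c *\<^sub>R edge nxt V i" for i
  proof -
    let ?e = "edge nxt V i" and ?e' = "edge nxt V (nxt i)"
    have "inv nxt (nxt i) = i"
      using bij by (simp add: bij_is_inj)
    then have "?e \<bullet> ?e' = norm ?e * norm ?e'"
      using turning_angle_bounds(3)[of nxt V "nxt i"] zero[of "nxt i"] nz[of i] nz[of "nxt i"]
      by (simp add: field_simps)
    then have "norm ?e *\<^sub>R ?e' = norm ?e' *\<^sub>R ?e"
      by (simp add: norm_cauchy_schwarz_eq)
    then have "inverse (norm ?e) *\<^sub>R norm ?e *\<^sub>R ?e' = inverse (norm ?e) *\<^sub>R norm ?e' *\<^sub>R ?e"
      by simp
    then have "?e' = (norm ?e' / norm ?e) *\<^sub>R ?e"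
      using nz[of i] by (simp add: divide_inverse mult.commute)
    then show ?thesis
      using nz by (intro exI[of _ "norm ?e' / norm ?e"]) simp
  qed
  fix i :: 'n
  let ?e = "edge nxt V i"
  have multiple: "\<exists>c>0. edge nxt V ((nxt ^^ k) i) = c *\<^sub>R ?e" for k
  proof (induction k)
    case 0
    show ?case by (auto intro: exI[of _ 1])
  next
    case (Suc k)
    then obtain c where c: "c > 0" "edge nxt V ((nxt ^^ k) i) = c *\<^sub>R ?e" by blast
    obtain c' where c': "c' > 0" "edge nxt V ((nxt ^^ Suc k) i) = c' *\<^sub>R edge nxt V ((nxt ^^ k) i)"
      using step by auto
    with c show ?case by (intro exI[of _ "c' * c"]) simp
  qed
  have increase: "0 < edge nxt V ((nxt ^^ k) i) \<bullet> ?e" for k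
    using multiple[of k] nz[of i] by auto
  have advance: "0 < (V $ (nxt ^^ Suc k) i - V $ i) \<bullet> ?e" for k
  proof (induction k)
    case 0
    show ?case using increase[of 0] by (simp add: edge_def)
  next
    case (Suc k)
    then show ?case using increase[of "Suc k"] by (simp add: edge_def inner_diff_left)
  qed
  obtain N where "0 < N" "(nxt ^^ N) i = i"
    using funpow_period[OF bij] .
  then obtain k where "(nxt ^^ Suc k) i = i"
    by (metis Suc_pred')
  then show False
    using advance[of k] by simp
qed


section \<open>The forward derivative of the constraint thickness\<close>

lemma tendsto_linear_bound: "((\<lambda>t::real. 1 + t * a) \<longlongrightarrow> 1) (at_right 0)"
proof -
  have "((\<lambda>t::real. 1 + t * a) \<longlongrightarrow> 1 + 0 * a) (at_right 0)"
    by (intro tendsto_intros)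
  then show ?thesis by simp
qed

lemma eventually_pos_at_right: "\<forall>\<^sub>F t in at_right 0. (0::real) < t"
  by (simp add: eventually_at_right_less)

context thick_polygon
begin

lemma side_edge_nonzero: "side_edge nxt V i s \<noteq> 0"
  using edge_nonzero by (cases s) simp_all

lemma min_rad_side_ge_1: "turning_angle nxt V i \<noteq> 0 \<Longrightarrow> 1 \<le> min_rad_side nxt i s V"
  using CThi_le_min_rad_side[of nxt V i l s] thick by simp

text \<open>A vertex that turns back on itself has MinRad zero, so it would make the thickness zero.\<close>

lemma turning_angle_neq_pi: "turning_angle nxt V i \<noteq> pi"
proof
  assume pi: "turning_angle nxt V i = pi"
  then have "min_rad_side nxt i Plus V = 0"
    by (simp add: min_rad_side_def)
  with min_rad_side_ge_1[of i Plus] pi show False by simp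
qed

definition active_gradients :: "(real^3^'n) set" where
  "active_gradients = (\<lambda>z. gradient (\<lambda>U. separation U z / 2) V) ` Strut nxt l V \<union>
     (\<lambda>(i, s). gradient (min_rad_side nxt i s) V) ` Kink nxt V"

lemma finite_active_gradients: "finite active_gradients"
proof -
  have "Kink nxt V \<subseteq> UNIV \<times> {Minus, Plus}"
    using side.exhaust by (auto simp: Kink_def)
  then have "finite (Kink nxt V)"
    by (rule finite_subset) simp
  then show ?thesis
    unfolding active_gradients_def using finite_Strut by simp
qed

lemma resolvable_motions_eq: "resolvable_motions nxt l V = convex_cone hull (uminus ` active_gradients)"
  unfolding resolvable_motions_def active_gradients_def image_Un image_image
  by (rule arg_cong[of _ _ "\<lambda>S. convex_cone hull S"]) (auto simp: case_prod_unfold)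

text \<open>A straight vertex may bend under the variation, but its turning angle stays small and its
  MinRad large. At a bent vertex MinRad is differentiable; it exceeds 1 with a margin unless it is
  a kink.\<close>

lemma min_rad_side_variation_ge:
  assumes a: "\<And>g. g \<in> active_gradients \<Longrightarrow> a < g \<bullet> W"
  shows "\<forall>\<^sub>F t in at_right 0. turning_angle nxt (V + t *\<^sub>R W) i \<noteq> 0 \<longrightarrow>
           1 + t * a \<le> min_rad_side nxt i s (V + t *\<^sub>R W)"
proof (cases "turning_angle nxt V i = 0")
  case True
  \<comment> \<open>Any bound above 1 would do for MinRad; the factor 4 gives the bound 2.\<close>
  have angle: "((\<lambda>t. turning_angle nxt (V + t *\<^sub>R W) i) \<longlongrightarrow> 0) (at_right 0)"
    using isCont_tendsto_variation[OF isCont_turning_angle[OF side_edge_nonzero], of W i] True by simp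
  then have "((\<lambda>t. 4 * tan (turning_angle nxt (V + t *\<^sub>R W) i / 2)) \<longlongrightarrow> 4 * tan (0 / 2)) (at_right 0)"
    by (intro tendsto_intros) auto
  moreover have "((\<lambda>t. norm (side_edge nxt (V + t *\<^sub>R W) i s)) \<longlongrightarrow> norm (side_edge nxt V i s)) (at_right 0)"
    by (intro tendsto_norm isCont_tendsto_variation differentiable_imp_continuous_within
        side_edge_differentiable)
  ultimately have "\<forall>\<^sub>F t in at_right 0. 4 * tan (turning_angle nxt (V + t *\<^sub>R W) i / 2)
      < norm (side_edge nxt (V + t *\<^sub>R W) i s)"
    using side_edge_nonzero by (intro eventually_less_of_tendsto) auto
  moreover have "\<forall>\<^sub>F t in at_right 0. turning_angle nxt (V + t *\<^sub>R W) i < pi"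
    using order_tendstoD(2)[OF angle pi_gt_zero] .
  moreover have "\<forall>\<^sub>F t in at_right 0. 1 + t * a < 2"
    by (rule order_tendstoD(2)[OF tendsto_linear_bound]) simp
  ultimately show ?thesis
  proof eventually_elim
    case (elim t)
    show ?case
    proof
      assume "turning_angle nxt (V + t *\<^sub>R W) i \<noteq> 0"
      then have "0 < tan (turning_angle nxt (V + t *\<^sub>R W) i / 2)"
        using elim(2) by (intro turning_angle_interior(1)) simp_all
      then have "2 \<le> min_rad_side nxt i s (V + t *\<^sub>R W)"
        using elim(1) unfolding min_rad_side_def by (simp add: field_simps)
      with elim(3) show "1 + t * a \<le> min_rad_side nxt i s (V + t *\<^sub>R W)"
        by simp
    qed
  qed
next
  case False
  let ?g = "min_rad_side nxt i s"
  have diff: "?g differentiable (at V)"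
    using side_edge_nonzero False turning_angle_neq_pi by (rule min_rad_side_differentiable)
  show ?thesis
  proof (cases "?g V = 1")
    case True
    then have "(i, s) \<in> Kink nxt V"
      using False by (simp add: Kink_def)
    then have "gradient ?g V \<in> active_gradients"
      unfolding active_gradients_def by force
    then have "\<forall>\<^sub>F t in at_right 0. a < (?g (V + t *\<^sub>R W) - ?g V) / t"
      by (intro order_tendstoD(1)[OF difference_quotient_tendsto_gradient[OF diff]] a)
    with eventually_pos_at_right show ?thesis
      by eventually_elim (simp add: True field_simps)
  next
    case False
    then have "1 < ?g V"
      using min_rad_side_ge_1[OF \<open>turning_angle nxt V i \<noteq> 0\<close>, of s] by simp
    moreover have "((\<lambda>t. ?g (V + t *\<^sub>R W)) \<longlongrightarrow> ?g V) (at_right 0)"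
      by (intro isCont_tendsto_variation differentiable_imp_continuous_within diff)
    ultimately have "\<forall>\<^sub>F t in at_right 0. 1 + t * a < ?g (V + t *\<^sub>R W)"
      using tendsto_linear_bound by (intro eventually_less_of_tendsto)
    then show ?thesis
      by eventually_elim simp
  qed
qed

text \<open>Along an interval of contacts the displacement is constant and the rate of separation affine,
  so the two struts that bound the interval control it.\<close>

lemma contact_rate_gt:
  assumes a: "\<And>g. g \<in> active_gradients \<Longrightarrow> a < g \<bullet> W" and z: "z \<in> contacts"
  shows "a < displacement V z \<bullet> displacement W z / (2 * separation V z)"
proof -
  let ?d = "displacement V z"
  obtain u v where uv: "u \<in> Strut nxt l V" "v \<in> Strut nxt l V" "z \<in> closed_segment u v"
    "displacement V u = ?d" "displacement V v = ?d"
    by (rule contact_between_struts[OF z])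
  \<comment> \<open>The factor 4 is twice the separation of a contact.\<close>
  have rate: "4 * a < ?d \<bullet> displacement W x" if "x \<in> Strut nxt l V" "displacement V x = ?d" for x
  proof -
    have "separation V x = 2"
      using that Strut_subset_contacts by (auto simp: contacts_def)
    then have "gradient (\<lambda>U. separation U x / 2) V \<bullet> W = ?d \<bullet> displacement W x / 4"
      using gradient_separation[of V x W] that(2) by simp
    moreover have "a < gradient (\<lambda>U. separation U x / 2) V \<bullet> W"
      using that(1) by (intro a) (auto simp: active_gradients_def)
    ultimately show ?thesis by simp
  qed
  obtain r where r: "0 \<le> r" "r \<le> 1" "z = (1 - r) *\<^sub>R u + r *\<^sub>R v"
    using uv(3) by (auto simp: in_segment)
  have "4 * a < (1 - r) * (?d \<bullet> displacement W u) + r * (?d \<bullet> displacement W v)"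
    using convex_bound_lt[of "- (?d \<bullet> displacement W u)" "- (4 * a)" "- (?d \<bullet> displacement W v)" "1 - r" r]
      r rate[OF uv(1,4)] rate[OF uv(2,5)] by simp
  also have "\<dots> = ?d \<bullet> displacement W z"
    by (simp add: r(3) displacement_combination inner_add_right)
  finally show ?thesis
    using z by (simp add: contacts_def)
qed

text \<open>Pairs whose rate of separation is at most \<open>a\<close> form a compact set without contacts. On it
  the separation exceeds 2 by a margin, which a small variation cannot use up.\<close>

lemma separation_variation_ge_uniform:
  assumes a: "\<And>g. g \<in> active_gradients \<Longrightarrow> a < g \<bullet> W"
  shows "\<forall>\<^sub>F t in at_right 0. \<forall>z\<in>VB1 nxt l. 1 + t * a \<le> separation (V + t *\<^sub>R W) z / 2"
proof -
  define rate where "rate z = displacement V z \<bullet> displacement W z / (2 * separation V z)" for z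
  define K where "K = VB1 nxt l \<inter> {z. rate z \<le> a}"
  have nz: "separation V z \<noteq> 0" if "z \<in> VB1 nxt l" for z
    using separation_ge_2[OF that] by simp
  have bound: "separation V z / 2 + t * rate z \<le> separation (V + t *\<^sub>R W) z / 2"
    if "z \<in> VB1 nxt l" for z t
  proof -
    let ?q = "displacement V z \<bullet> displacement W z / separation V z"
    have "separation V z / 2 + t * rate z = (separation V z + t * ?q) / 2"
      by (simp add: rate_def add_divide_distrib)
    with separation_variation_ge[OF nz[OF that], of t W] show ?thesis
      by simp
  qed
  have rate_cont: "continuous_on (VB1 nxt l) rate"
    unfolding rate_def using nz by (intro continuous_intros) auto
  have "\<exists>\<delta>>0. \<exists>B. \<forall>z\<in>K. 1 + \<delta> \<le> separation V z / 2 \<and> B \<le> rate z"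
  proof (cases "K = {}")
    case True
    then show ?thesis by (auto intro: exI[of _ 1])
  next
    case False
    have "compact (VB1 nxt l)"
      by (rule compact_VB1[OF polygon_assms])
    then have "compact K"
      unfolding K_def
      using continuous_closedin_preimage[OF rate_cont, of "{..a}"]
      by (auto intro: closedin_compact simp: vimage_def)
    moreover have "continuous_on K rate"
      using rate_cont by (rule continuous_on_subset) (simp add: K_def)
    ultimately obtain x y where x: "x \<in> K" "\<forall>z\<in>K. separation V x \<le> separation V z"
      and y: "y \<in> K" "\<forall>z\<in>K. rate y \<le> rate z"
      using continuous_attains_inf[OF _ False] continuous_on_separation by metis
    have "a < rate x" if "x \<in> contacts"
      unfolding rate_def using a that by (rule contact_rate_gt)
    then have "x \<notin> contacts"
      using x(1) by (auto simp: K_def)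
    then have "2 < separation V x"
      using x(1) contactsI[of x] by (cases "separation V x \<le> 2") (auto simp: K_def)
    with x(2) y(2) show ?thesis
      by (intro exI[of _ "separation V x / 2 - 1"] conjI exI[of _ "rate y"]) auto
  qed
  then obtain \<delta> B where \<delta>: "0 < \<delta>" and K: "\<And>z. z \<in> K \<Longrightarrow> 1 + \<delta> \<le> separation V z / 2 \<and> B \<le> rate z"
    by blast
  have "((\<lambda>t::real. t * (a - B)) \<longlongrightarrow> 0 * (a - B)) (at_right 0)"
    by (intro tendsto_intros)
  then have "\<forall>\<^sub>F t in at_right 0. t * (a - B) < \<delta>"
    using \<delta> by (intro order_tendstoD(2)) auto
  with eventually_pos_at_right show ?thesis
  proof eventually_elim
    case (elim t)
    show ?case
    proof
      fix z
      assume z: "z \<in> VB1 nxt l"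
      have "1 + t * a \<le> separation V z / 2 + t * rate z"
      proof (cases "z \<in> K")
        case True
        have "1 + t * a \<le> 1 + \<delta> + t * B"
          using elim(2) by (simp add: algebra_simps)
        also have "\<dots> \<le> separation V z / 2 + t * rate z"
          using K[OF True] elim(1) by (intro add_mono mult_left_mono) auto
        finally show ?thesis .
      next
        case False
        then have "a \<le> rate z"
          using z by (simp add: K_def)
        then show ?thesis
          using separation_ge_2[OF z] elim(1) by (intro add_mono mult_left_mono) auto
      qed
      then show "1 + t * a \<le> separation (V + t *\<^sub>R W) z / 2"
        using bound[OF z] by (rule order_trans)
    qed
  qed
qed

text \<open>The infimum is over a nonempty set for small variations, since some vertex is bent and
  stays bent.\<close>

lemma CThi_variation_ge:
  assumes a: "\<And>g. g \<in> active_gradients \<Longrightarrow> a < g \<bullet> W"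
  shows "\<forall>\<^sub>F t in at_right 0. 1 + t * a \<le> CThi nxt l (V + t *\<^sub>R W)"
proof -
  obtain j where j: "turning_angle nxt V j \<noteq> 0"
    by (rule exists_turning_angle_nonzero[OF closed_polygon])
  have "\<forall>\<^sub>F t in at_right 0. turning_angle nxt (V + t *\<^sub>R W) j \<noteq> 0"
    using isCont_tendsto_variation[OF isCont_turning_angle[OF side_edge_nonzero]] j
    by (rule tendsto_imp_eventually_ne)
  moreover have "\<forall>\<^sub>F t in at_right 0. \<forall>i. \<forall>s\<in>{Minus, Plus}. turning_angle nxt (V + t *\<^sub>R W) i \<noteq> 0 \<longrightarrow>
      1 + t * a \<le> min_rad_side nxt i s (V + t *\<^sub>R W)"
    by (intro eventually_all_finite eventually_ball_finite ballI min_rad_side_variation_ge a) auto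
  moreover have "\<forall>\<^sub>F t in at_right 0. \<forall>z\<in>VB1 nxt l. 1 + t * a \<le> separation (V + t *\<^sub>R W) z / 2"
    by (rule separation_variation_ge_uniform[OF a])
  ultimately show ?thesis
  proof eventually_elim
    case (elim t)
    show ?case
      unfolding CThi_def
    proof (rule cInf_greatest)
      show "thickness_values nxt l (V + t *\<^sub>R W) \<noteq> {}"
        using elim(1) by blast
      show "1 + t * a \<le> x" if "x \<in> thickness_values nxt l (V + t *\<^sub>R W)" for x
        using that elim(2,3) by (auto simp: min_rad_def)
    qed
  qed
qed

text \<open>If nothing were active, the lower bound would hold at the trivial variation for every
  slope.\<close>

lemma active_gradients_nonempty:
  assumes "CThi nxt l V = 1"
  shows "active_gradients \<noteq> {}"
proof
  assume "active_gradients = {}"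
  then have "\<forall>\<^sub>F t in at_right 0. 1 + t * 1 \<le> CThi nxt l (V + t *\<^sub>R 0)"
    by (intro CThi_variation_ge) auto
  with eventually_pos_at_right have "\<forall>\<^sub>F t in at_right (0::real). False"
    by eventually_elim (simp add: assms)
  then show False
    by simp
qed

text \<open>An active strut or kink remains one of the values over which the thickness is the infimum, so
  its own derivative bounds that of the thickness from above.\<close>

lemma CThi_quotient_less:
  assumes "CThi nxt l V = 1" "g \<in> active_gradients" "g \<bullet> W < b"
  shows "\<forall>\<^sub>F t in at_right 0. (CThi nxt l (V + t *\<^sub>R W) - CThi nxt l V) / t < b"
proof -
  have "\<exists>h. h differentiable (at V) \<and> gradient h V = g \<and> h V = 1 \<and>
      (\<forall>\<^sub>F t in at_right 0. CThi nxt l (V + t *\<^sub>R W) \<le> h (V + t *\<^sub>R W))"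
    using assms(2) unfolding active_gradients_def
  proof (elim UnE imageE)
    fix z
    assume g: "g = gradient (\<lambda>U. separation U z / 2) V" and z: "z \<in> Strut nxt l V"
    then have "z \<in> VB1 nxt l" "separation V z = 2"
      by (simp_all add: Strut_def)
    with g show ?thesis
      by (intro exI[of _ "\<lambda>U. separation U z / 2"] conjI separation_differentiable
          always_eventually allI CThi_le_separation) simp_all
  next
    fix k
    assume g: "g = (\<lambda>(i, s). gradient (min_rad_side nxt i s) V) k" and k: "k \<in> Kink nxt V"
    obtain i s where k_eq: "k = (i, s)" by (cases k)
    then have angle: "turning_angle nxt V i \<noteq> 0" and "min_rad_side nxt i s V = 1"
      using k by (simp_all add: Kink_def)
    moreover have "min_rad_side nxt i s differentiable (at V)"
      using side_edge_nonzero angle turning_angle_neq_pi by (rule min_rad_side_differentiable)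
    moreover have "\<forall>\<^sub>F t in at_right 0. turning_angle nxt (V + t *\<^sub>R W) i \<noteq> 0"
      using isCont_tendsto_variation[OF isCont_turning_angle[OF side_edge_nonzero]] angle
      by (rule tendsto_imp_eventually_ne)
    then have "\<forall>\<^sub>F t in at_right 0. CThi nxt l (V + t *\<^sub>R W) \<le> min_rad_side nxt i s (V + t *\<^sub>R W)"
      by eventually_elim (rule CThi_le_min_rad_side)
    ultimately show ?thesis
      using g k_eq by (intro exI[of _ "min_rad_side nxt i s"]) simp
  qed
  then obtain h where h: "h differentiable (at V)" "gradient h V = g" "h V = 1"
    and le: "\<forall>\<^sub>F t in at_right 0. CThi nxt l (V + t *\<^sub>R W) \<le> h (V + t *\<^sub>R W)"
    by blast
  have "\<forall>\<^sub>F t in at_right 0. (h (V + t *\<^sub>R W) - h V) / t < b"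
    using order_tendstoD(2)[OF difference_quotient_tendsto_gradient[OF h(1)]] assms(3) h(2) by simp
  with le eventually_pos_at_right show ?thesis
  proof eventually_elim
    case (elim t)
    have "(CThi nxt l (V + t *\<^sub>R W) - CThi nxt l V) / t \<le> (h (V + t *\<^sub>R W) - h V) / t"
      using elim(1,2) assms(1) h(3) by (intro divide_right_mono) auto
    with elim(3) show ?case by simp
  qed
qed

text \<open>The lower bound is available for every slope below the minimum, and an active gradient that
  attains the minimum gives the upper bound.\<close>

lemma forward_deriv_CThi:
  assumes "CThi nxt l V = 1"
  shows "forward_deriv W (CThi nxt l) V = Min ((\<lambda>g. g \<bullet> W) ` active_gradients)"
proof (rule forward_deriv_eqI, rule order_tendstoI)
  let ?A = "(\<lambda>g. g \<bullet> W) ` active_gradients"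
  have fin: "finite ?A" "?A \<noteq> {}"
    using finite_active_gradients active_gradients_nonempty[OF assms] by auto
  {
    fix b
    assume less: "Min ?A < b"
    obtain g where g: "g \<in> active_gradients" "Min ?A = g \<bullet> W"
      using Min_in[OF fin] by auto
    show "\<forall>\<^sub>F t in at_right 0. (CThi nxt l (V + t *\<^sub>R W) - CThi nxt l V) / t < b"
      using less unfolding g(2) by (rule CThi_quotient_less[OF assms g(1)])
  next
    fix b
    assume "b < Min ?A"
    then obtain a where a: "b < a" "a < Min ?A"
      using dense by blast
    then have "a < g \<bullet> W" if "g \<in> active_gradients" for g
      using that fin by (simp add: Min_gr_iff)
    then have "\<forall>\<^sub>F t in at_right 0. 1 + t * a \<le> CThi nxt l (V + t *\<^sub>R W)"
      by (rule CThi_variation_ge)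
    with eventually_pos_at_right
    show "\<forall>\<^sub>F t in at_right 0. b < (CThi nxt l (V + t *\<^sub>R W) - CThi nxt l V) / t"
    proof eventually_elim
      case (elim t)
      then have "a \<le> (CThi nxt l (V + t *\<^sub>R W) - CThi nxt l V) / t"
        by (simp add: assms field_simps)
      with a(1) show ?case by simp
    qed
  }
qed

lemma active_gradients_empty:
  assumes "CThi nxt l V > 1"
  shows "active_gradients = {}"
proof -
  have "separation V z / 2 \<noteq> 1" if "z \<in> VB1 nxt l" for z
    using CThi_le_separation[OF that, of V] assms by simp
  then have "Strut nxt l V = {}"
    unfolding Strut_def by blast
  moreover have "min_rad_side nxt i s V \<noteq> 1" if "turning_angle nxt V i \<noteq> 0" for i s
    using CThi_le_min_rad_side[OF that, of l s] assms by simp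
  then have "Kink nxt V = {}"
    unfolding Kink_def by blast
  ultimately show ?thesis
    by (simp add: active_gradients_def)
qed

lemma infinitesimal_motions_eq:
  "infinitesimal_motions nxt l V = {W. \<forall>g\<in>active_gradients. 0 \<le> g \<bullet> W}"
proof (cases "CThi nxt l V > 1")
  case True
  then show ?thesis
    by (simp add: infinitesimal_motions_def active_gradients_empty)
next
  case False
  then have "CThi nxt l V = 1" using thick by simp
  then show ?thesis
    using finite_active_gradients active_gradients_nonempty
    by (auto simp: infinitesimal_motions_def forward_deriv_CThi)
qed

lemma convex_cone_infinitesimal_motions: "convex_cone (infinitesimal_motions nxt l V)"
  unfolding infinitesimal_motions_eq by (auto simp: convex_cone_iff inner_add_right)

lemma closed_infinitesimal_motions: "closed (infinitesimal_motions nxt l V)"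
proof -
  have "infinitesimal_motions nxt l V = (\<Inter>g\<in>active_gradients. {W. 0 \<le> g \<bullet> W})"
    unfolding infinitesimal_motions_eq by blast
  moreover have "closed (\<Inter>g\<in>active_gradients. {W. 0 \<le> g \<bullet> W})"
    by (intro closed_INT ballI closed_Collect_le continuous_intros)
  ultimately show ?thesis by simp
qed

text \<open>The infinitesimal motions are the polar cone of the negated active gradients, so Farkas' lemma
  identifies their polar.\<close>

lemma mem_resolvable_motions_iff:
  "m \<in> resolvable_motions nxt l V \<longleftrightarrow> (\<forall>W\<in>infinitesimal_motions nxt l V. m \<bullet> W \<le> 0)"
proof -
  have "finite (uminus ` active_gradients)"
    using finite_active_gradients by simp
  then show ?thesis
    unfolding resolvable_motions_eq infinitesimal_motions_eq
    by (simp add: mem_convex_cone_hull_iff_polar)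
qed

text \<open>Where the thickness is 1, this is the contrapositive of the defining condition. Where it
  exceeds 1, every variation is an infinitesimal motion, and a linear functional that is bounded on
  one side vanishes.\<close>

lemma thickness_critical_iff:
  assumes "f differentiable (at V)"
  shows "thickness_critical nxt l f V \<longleftrightarrow>
    (\<forall>W\<in>infinitesimal_motions nxt l V. - gradient f V \<bullet> W \<le> 0)"
proof -
  have fd: "forward_deriv W f V = gradient f V \<bullet> W" for W
    using assms by (rule forward_deriv_eq_gradient)
  show ?thesis
  proof (cases "CThi nxt l V > 1")
    case True
    then have "thickness_critical nxt l f V \<longleftrightarrow> (\<forall>W. gradient f V \<bullet> W = 0)"
      by (auto simp: thickness_critical_def fd)
    also have "\<dots> \<longleftrightarrow> (\<forall>W. 0 \<le> gradient f V \<bullet> W)"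
    proof (intro iffI allI)
      fix W
      assume nonneg: "\<forall>W. 0 \<le> gradient f V \<bullet> W"
      from nonneg[rule_format, of W] nonneg[rule_format, of "- W"]
      show "gradient f V \<bullet> W = 0" by simp
    qed simp
    finally show ?thesis
      using True by (simp add: infinitesimal_motions_def)
  next
    case False
    then have "CThi nxt l V = 1" using thick by simp
    then show ?thesis
      unfolding thickness_critical_def infinitesimal_motions_def fd
      by (auto simp: not_less[symmetric])
  qed
qed

end

section \<open>Criticality, balance and the constrained gradient\<close>

theorem theorem2p18:
  fixes nxt :: "'n::finite \<Rightarrow> 'n" and V :: "real^3^'n"
    and f :: "real^3^'n \<Rightarrow> real" and l :: real
  assumes "l > 0"
    and "closed_polygon nxt V"
    and "CThi nxt l V \<ge> 1"
    and "\<And>U. f differentiable (at U)"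
  shows "(thickness_critical nxt l f V \<longleftrightarrow> - gradient f V \<in> resolvable_motions nxt l V) \<and>
         (- gradient f V \<in> resolvable_motions nxt l V \<longleftrightarrow> constrained_gradient nxt l f V = 0)"
proof -
  interpret thick_polygon nxt l V
    using assms by unfold_locales
  show ?thesis
    unfolding constrained_gradient_def mem_resolvable_motions_iff
      thickness_critical_iff[OF assms(4)]
      closest_point_cone_eq_0_iff[OF convex_cone_infinitesimal_motions closed_infinitesimal_motions]
    by blast
qed

end
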